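(* Let $t \geq 2$ be an integer. Every $K_t$-minor-free graph $G$ is isomorphic to a subgraph of $H \boxtimes K_m$ for some graph $H$ with $\mathrm{tw}(H) \leq t - 2$, where $m := \mathrm{tw}(G) + 1$.
   Context: All graphs are finite, simple and undirected. $\mathrm{tw}$ denotes treewidth. The strong product $A \boxtimes B$ of graphs has vertex-set $V(A)\times V(B)$, where distinct $(v,x),(w,y)$ are adjacent if ($v=w$ and $xy\in E(B)$), or ($x=y$ and $vw\in E(A)$), or ($vw\in E(A)$ and $xy\in E(B)$). $K_m$ is the complete graph on $m$ vertices. *)

theory Defs
  imports "Graph_Theory.Graph_Theory"
begin

text \<open>
  A finite simple undirected graph is a \<^locale>\<open>pair_graph\<close>: each edge is represented by the two
  arcs joining its ends. On such graphs \<^const>\<open>digraph_iso\<close> is ordinary graph isomorphism. Since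
  \<^const>\<open>subgraph\<close> also admits digraphs that contain only one of the two arcs of an edge, it is
  always accompanied by \<^locale>\<open>pair_graph\<close>.
\<close>

definition isomorphic_to_subgraph :: "'a pair_pre_digraph \<Rightarrow> 'b pair_pre_digraph \<Rightarrow> bool" where
  "isomorphic_to_subgraph G X \<longleftrightarrow>
     (\<exists>S. pair_graph S \<and> subgraph (with_proj S) (with_proj X)
        \<and> digraph_iso (with_proj G) (with_proj S))"

definition complete_graph :: "nat \<Rightarrow> nat pair_pre_digraph" where
  "complete_graph n = \<lparr> pverts = {..<n}, parcs = {(i, j). i < n \<and> j < n \<and> i \<noteq> j} \<rparr>"

definition strong_product ::
    "'a pair_pre_digraph \<Rightarrow> 'b pair_pre_digraph \<Rightarrow> ('a \<times> 'b) pair_pre_digraph" (infixl \<open>\<boxtimes>\<close> 70) where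
  "A \<boxtimes> B = \<lparr> pverts = pverts A \<times> pverts B,
     parcs = {((v, x), (w, y)).
       v \<in> pverts A \<and> w \<in> pverts A \<and> x \<in> pverts B \<and> y \<in> pverts B \<and> (v, x) \<noteq> (w, y) \<and>
       (v = w \<and> (x, y) \<in> parcs B \<or>
        x = y \<and> (v, w) \<in> parcs A \<or>
        (v, w) \<in> parcs A \<and> (x, y) \<in> parcs B)} \<rparr>"

text \<open>Contracting the edge \<open>uv\<close> merges \<open>v\<close> into \<open>u\<close>; the resulting loop is removed.\<close>

definition contract_edge :: "'a pair_pre_digraph \<Rightarrow> 'a \<Rightarrow> 'a \<Rightarrow> 'a pair_pre_digraph" where
  "contract_edge G u v =
     (let f = (\<lambda>x. if x = v then u else x)
      in \<lparr> pverts = f ` pverts G,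
           parcs = {(f x, f y) | x y. (x, y) \<in> parcs G \<and> f x \<noteq> f y} \<rparr>)"

inductive contracts_to :: "'a pair_pre_digraph \<Rightarrow> 'a pair_pre_digraph \<Rightarrow> bool" for G where
  refl: "contracts_to G G"
| step: "contracts_to G C \<Longrightarrow> (u, v) \<in> parcs C \<Longrightarrow> contracts_to G (contract_edge C u v)"

definition is_minor :: "'b pair_pre_digraph \<Rightarrow> 'a pair_pre_digraph \<Rightarrow> bool" where
  "is_minor X G \<longleftrightarrow>
     (\<exists>S C. pair_graph S \<and> subgraph (with_proj S) (with_proj G)
        \<and> contracts_to S C \<and> digraph_iso (with_proj C) (with_proj X))"

text \<open>
  The library's \<^const>\<open>tree\<close> is meant for directed graphs: the two arcs of an undirected edge
  form a \<^const>\<open>pre_digraph.cycle\<close> of length two. The cycles of an undirected graph are those of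
  length at least three.
\<close>

definition undirected_tree :: "'a pair_pre_digraph \<Rightarrow> bool" where
  "undirected_tree T \<longleftrightarrow>
     pair_graph T \<and> connected (with_proj T) \<and>
     \<not> (\<exists>p. pre_digraph.cycle (with_proj T) p \<and> 3 \<le> length p)"

text \<open>\<^const>\<open>connected\<close> includes nonemptiness, so every vertex lies in some bag.\<close>

definition tree_decomposition ::
    "'a pair_pre_digraph \<Rightarrow> 'b pair_pre_digraph \<Rightarrow> ('b \<Rightarrow> 'a set) \<Rightarrow> bool" where
  "tree_decomposition G T B \<longleftrightarrow>
     undirected_tree T \<and>
     (\<forall>x \<in> pverts T. B x \<subseteq> pverts G) \<and>
     (\<forall>(v, w) \<in> parcs G. \<exists>x \<in> pverts T. v \<in> B x \<and> w \<in> B x) \<and>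
     (\<forall>v \<in> pverts G. connected (with_proj T \<restriction> {x \<in> pverts T. v \<in> B x}))"

definition width :: "'b pair_pre_digraph \<Rightarrow> ('b \<Rightarrow> 'a set) \<Rightarrow> int" where
  "width T B = int (Max ((\<lambda>x. card (B x)) ` pverts T)) - 1"

text \<open>
  Trees are finite, so it suffices to take their nodes from \<^typ>\<open>nat\<close>. The graph without vertices
  has treewidth \<open>-1\<close>.
\<close>

definition treewidth :: "'a pair_pre_digraph \<Rightarrow> int" where
  "treewidth G =
     (LEAST k. \<exists>(T :: nat pair_pre_digraph) B. tree_decomposition G T B \<and> width T B = k)"

lemma complete_digraph_complete_graph: "complete_digraph n (with_proj (complete_graph n))"
proof -
  have fin: "finite {(i, j). i < n \<and> j < n \<and> i \<noteq> j}"
    by (rule finite_subset[of _ "{..<n} \<times> {..<n}"]) auto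
  have "pair_graph (complete_graph n)"
    by unfold_locales
      (auto simp: complete_graph_def symmetric_def arcs_ends_def arc_to_ends_def sym_def fin)
  then interpret pair_graph "complete_graph n" .
  have "graph (with_proj (complete_graph n))" by unfold_locales
  then show ?thesis
    by (auto simp: complete_digraph_def complete_graph_def arcs_ends_def arc_to_ends_def)
qed

lemma pair_graph_strong_product:
  assumes "pair_graph A" "pair_graph B"
  shows "pair_graph (A \<boxtimes> B)"
proof -
  interpret A: pair_graph A by fact
  interpret B: pair_graph B by fact
  have sA: "(a, b) \<in> parcs A \<longleftrightarrow> (b, a) \<in> parcs A" for a b
    using A.pair_sym_arcs by (auto simp: symmetric_def sym_def arcs_ends_def arc_to_ends_def)
  have sB: "(a, b) \<in> parcs B \<longleftrightarrow> (b, a) \<in> parcs B" for a b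
    using B.pair_sym_arcs by (auto simp: symmetric_def sym_def arcs_ends_def arc_to_ends_def)
  have fin: "finite (parcs (A \<boxtimes> B))"
    by (rule finite_subset[of _ "(pverts A \<times> pverts B) \<times> (pverts A \<times> pverts B)"])
      (auto simp: strong_product_def A.pair_finite_verts B.pair_finite_verts)
  have sym: "symmetric (with_proj (A \<boxtimes> B))"
    unfolding symmetric_def sym_def arcs_ends_def arc_to_ends_def
    using sA sB by (auto simp: strong_product_def)
  show ?thesis
    by unfold_locales
      (use fin sym in \<open>auto simp: strong_product_def A.pair_finite_verts B.pair_finite_verts\<close>)
qed

lemma treewidth_attained:
  fixes G :: "'a pair_pre_digraph"
  assumes "pair_graph G"
  shows "\<exists>(T :: nat pair_pre_digraph) B. tree_decomposition G T B \<and> width T B = treewidth G"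
    and "tree_decomposition G (T :: nat pair_pre_digraph) B \<Longrightarrow> treewidth G \<le> width T B"
proof -
  interpret pair_graph G by fact
  define P where "P k \<longleftrightarrow> (\<exists>(T :: nat pair_pre_digraph) B. tree_decomposition G T B \<and> width T B = k)"
    for k :: int
  define T0 :: "nat pair_pre_digraph" where "T0 = \<lparr> pverts = {0}, parcs = {} \<rparr>"
  have pg: "pair_graph T0"
    by unfold_locales (auto simp: T0_def symmetric_def arcs_ends_def sym_def)
  then interpret T0: pair_graph T0 .
  have conn: "connected (with_proj T0)"
    by (auto simp: connected_def strongly_connected_def mk_symmetric_def T0_def reachable_def)
  have "\<not> T0.cycle p" for p
    unfolding T0.cycle_def T0.awalk_def by (auto simp: T0_def)
  moreover have "with_proj T0 \<restriction> {x \<in> pverts T0. v \<in> pverts G} = with_proj T0"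
    if "v \<in> pverts G" for v
    using that by (auto simp: T0_def induce_subgraph_def with_proj_def)
  moreover have "v \<in> pverts G \<and> w \<in> pverts G" if "(v, w) \<in> parcs G" for v w
    using that arc_fst_in_verts arc_snd_in_verts by fastforce
  moreover have "0 \<in> pverts T0" by (simp add: T0_def)
  ultimately have "tree_decomposition G T0 (\<lambda>_. pverts G)"
    unfolding tree_decomposition_def undirected_tree_def
    using pg conn by (simp del: Collect_conv_if) blast
  then have ex: "P (width T0 (\<lambda>_. pverts G))" by (auto simp: P_def)
  have lb: "P k \<Longrightarrow> - 1 \<le> k" for k by (auto simp: P_def width_def)
  define n where "n = (LEAST n. P (int n - 1))"
  have nat: "P k \<Longrightarrow> P (int (nat (k + 1)) - 1)" for k using lb[of k] by auto
  have n: "P (int n - 1)" unfolding n_def using nat[OF ex] by (rule LeastI)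
  have min: "int n - 1 \<le> k" if "P k" for k
    using Least_le[of "\<lambda>n. P (int n - 1)", OF nat[OF that]] lb[OF that] by (simp add: n_def)
  have tw: "treewidth G = int n - 1"
    unfolding treewidth_def P_def[symmetric] using n min by (rule Least_equality)
  show "\<exists>(T :: nat pair_pre_digraph) B. tree_decomposition G T B \<and> width T B = treewidth G"
    using n tw by (simp add: P_def)
  show "treewidth G \<le> width T B" if "tree_decomposition G (T :: nat pair_pre_digraph) B"
    using min tw that by (auto simp: P_def)
qed

end

theory Submission
  imports Defs
begin

text \<open>
  Pairwise intersecting connected vertex sets of \<open>G\<close> are all met by a single bag of an optimal tree
  decomposition, by the Helly property of subtrees; hence they have a hitting set of size at most
  \<open>tw(G) + 1\<close>. The parts of the partition of \<open>V(G)\<close> indexed by \<open>V(H)\<close> are chosen one at a time as such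
  hitting sets.

  Let \<open>C\<close> be a component of the part of \<open>G\<close> that is not yet covered, and suppose that the parts seen
  by \<open>C\<close> are contained in pairwise touching, disjoint, connected sets \<open>A\<^sub>1, \<dots>, A\<^sub>r\<close> that avoid \<open>C\<close> and
  touch it. Together with \<open>C\<close> they form a \<open>K\<^bsub>r+1\<^esub>\<close> model, so \<open>r \<le> t - 2\<close>. Let \<open>S\<close> be a minimal set that
  meets every connected \<open>X \<subseteq> C\<close> touching all \<open>A\<^sub>i\<close> such that \<open>C - X\<close> contains no connected set
  touching all \<open>A\<^sub>i\<close>; these \<open>X\<close> pairwise intersect. For a component \<open>C'\<close> of \<open>C - S\<close>, either some \<open>A\<^sub>k\<close> does
  not touch \<open>C'\<close>, and then \<open>A\<^sub>k\<close> grows to a branch set containing \<open>S\<close>, or \<open>C - C'\<close> contains a connected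
  set touching all \<open>A\<^sub>i\<close>, which grows to a new branch set containing \<open>S\<close>. So the situation is inherited
  by \<open>C'\<close>. Every new part is joined in \<open>H\<close> to a clique of at most \<open>t - 2\<close> earlier parts, whence
  \<open>tw(H) \<le> t - 2\<close>.
\<close>

section \<open>Connected vertex sets\<close>

text \<open>Phrased for a bare arc relation, so that the same lemmas serve the graph and the tree of
  its decomposition. Nonemptiness matches the library's \<open>connected\<close>.\<close>

definition connected_on :: "'a rel \<Rightarrow> 'a set \<Rightarrow> bool" where
  "connected_on E X \<longleftrightarrow> X \<noteq> {} \<and> (\<forall>x\<in>X. \<forall>y\<in>X. (x, y) \<in> (Restr E X)\<^sup>*)"

definition touching :: "'a rel \<Rightarrow> 'a set \<Rightarrow> 'a set \<Rightarrow> bool" where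
  "touching E X Y \<longleftrightarrow> (\<exists>x\<in>X. \<exists>y\<in>Y. (x, y) \<in> E)"

lemma touching_commute: "sym E \<Longrightarrow> touching E X Y \<longleftrightarrow> touching E Y X"
  by (auto simp: touching_def sym_def)

lemma touching_mono: "touching E X Y \<Longrightarrow> X \<subseteq> X' \<Longrightarrow> Y \<subseteq> Y' \<Longrightarrow> touching E X' Y'"
  by (auto simp: touching_def)

lemma connected_on_not_empty: "connected_on E X \<Longrightarrow> X \<noteq> {}"
  by (simp add: connected_on_def)

lemma connected_onD: "connected_on E X \<Longrightarrow> x \<in> X \<Longrightarrow> y \<in> X \<Longrightarrow> (x, y) \<in> (Restr E X)\<^sup>*"
  by (simp add: connected_on_def)

lemma connected_on_singleton: "connected_on E {x}"
  by (simp add: connected_on_def)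

lemma rtrancl_Restr_mono: "(x, y) \<in> (Restr E X)\<^sup>* \<Longrightarrow> X \<subseteq> Y \<Longrightarrow> (x, y) \<in> (Restr E Y)\<^sup>*"
  by (erule rtrancl_mono[THEN subsetD, rotated]) auto

lemma rtrancl_Restr_sym: "sym E \<Longrightarrow> (x, y) \<in> (Restr E X)\<^sup>* \<Longrightarrow> (y, x) \<in> (Restr E X)\<^sup>*"
  by (rule symD[OF sym_rtrancl]) (auto simp: sym_def)

text \<open>By symmetry a walk from the root can be reversed, so two walks from \<open>a\<close>
  combine into one between any two vertices.\<close>

lemma connected_on_rootI:
  assumes "sym E" "a \<in> X" "\<And>x. x \<in> X \<Longrightarrow> (a, x) \<in> (Restr E X)\<^sup>*"
  shows "connected_on E X"
  unfolding connected_on_def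
proof (intro conjI ballI)
  fix x y assume "x \<in> X" "y \<in> X"
  then show "(x, y) \<in> (Restr E X)\<^sup>*"
    using assms(3) rtrancl_Restr_sym[OF assms(1)] by (meson rtrancl_trans)
qed (use assms in auto)

lemma connected_on_Un:
  assumes "sym E" "connected_on E X" "connected_on E Y" "X \<inter> Y \<noteq> {} \<or> touching E X Y"
  shows "connected_on E (X \<union> Y)"
proof -
  obtain a b where ab: "a \<in> X" "b \<in> Y" "a = b \<or> (a, b) \<in> E"
    using assms(4) by (auto simp: touching_def)
  have 1: "(a, b) \<in> (Restr E (X \<union> Y))\<^sup>*" using ab by auto
  show ?thesis
  proof (rule connected_on_rootI[OF assms(1)])
    show "a \<in> X \<union> Y" using ab by simp
    fix x assume "x \<in> X \<union> Y"
    then consider "x \<in> X" | "x \<in> Y" by blast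
    then show "(a, x) \<in> (Restr E (X \<union> Y))\<^sup>*"
    proof cases
      case 1
      then show ?thesis using rtrancl_Restr_mono[OF connected_onD[OF assms(2) ab(1)]] by blast
    next
      case 2
      then have "(b, x) \<in> (Restr E (X \<union> Y))\<^sup>*"
        using rtrancl_Restr_mono[OF connected_onD[OF assms(3) ab(2)]] by blast
      with 1 show ?thesis by (rule rtrancl_trans)
    qed
  qed
qed

lemma connected_on_UN:
  assumes "sym E" "I \<noteq> {}" "\<And>i. i \<in> I \<Longrightarrow> connected_on E (X i)" "\<And>i. i \<in> I \<Longrightarrow> a \<in> X i"
  shows "connected_on E (\<Union>i\<in>I. X i)"
proof (rule connected_on_rootI[OF assms(1)])
  show "a \<in> (\<Union>i\<in>I. X i)" using assms by blast
  fix x assume "x \<in> (\<Union>i\<in>I. X i)"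
  then obtain i where "i \<in> I" "x \<in> X i" by blast
  then show "(a, x) \<in> (Restr E (\<Union>i\<in>I. X i))\<^sup>*"
    by (intro rtrancl_Restr_mono[OF connected_onD[OF assms(3) assms(4)]]) auto
qed

text \<open>A walk from \<open>Y\<close> to a vertex outside \<open>Y\<close> has to leave
  \<open>Y\<close> along some arc.\<close>

lemma connected_on_crossing:
  assumes "connected_on E X" "Y \<subseteq> X" "Y \<noteq> {}" "Y \<noteq> X"
  shows "touching E Y (X - Y)"
proof (rule ccontr)
  assume no: "\<not> touching E Y (X - Y)"
  obtain y x where yx: "y \<in> Y" "x \<in> X - Y" using assms by blast
  have "(y, x) \<in> (Restr E X)\<^sup>*" using yx assms by (auto intro: connected_onD)
  then have "x \<in> Y" using yx(1) no by induct (auto simp: touching_def)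
  with yx show False by simp
qed

section \<open>Components of a vertex set\<close>

definition component_of :: "'a rel \<Rightarrow> 'a set \<Rightarrow> 'a set \<Rightarrow> bool" where
  "component_of E R C \<longleftrightarrow> connected_on E C \<and> C \<subseteq> R \<and> \<not> touching E C (R - C)"

lemma component_of_exists:
  assumes "sym E" "x \<in> R"
  shows "\<exists>C. component_of E R C \<and> x \<in> C"
proof -
  define C where "C = {y \<in> R. (x, y) \<in> (Restr E R)\<^sup>*}"
  \<comment> \<open>Every vertex visited by a walk inside \<open>R\<close> from \<open>x\<close>
    lies in \<open>C\<close>, so the walk stays inside \<open>C\<close>.\<close>
  have *: "(x, y) \<in> (Restr E C)\<^sup>*" if "(x, y) \<in> (Restr E R)\<^sup>*" for y
    using that
  proof induct
    case (step y z)
    then have "z \<in> C" by (auto simp: C_def intro: rtrancl_into_rtrancl)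
    moreover have "y \<in> C" using step by (auto simp: C_def)
    ultimately show ?case using step by (auto intro: rtrancl_into_rtrancl)
  qed simp
  have "connected_on E C"
    by (rule connected_on_rootI[OF assms(1), of x]) (use assms * in \<open>auto simp: C_def\<close>)
  moreover have "\<not> touching E C (R - C)"
    by (auto simp: touching_def C_def intro: rtrancl_into_rtrancl)
  ultimately show ?thesis
    using assms by (intro exI[of _ C]) (auto simp: component_of_def C_def)
qed

text \<open>A walk inside \<open>X\<close> can enter and leave \<open>C'\<close> only through \<open>s\<close>.\<close>

lemma connected_on_minus_component:
  assumes E: "sym E" and X: "connected_on E X" "X \<subseteq> C" "X \<inter> S = {s}"
    and C': "component_of E (C - S) C'"
  shows "connected_on E (X - C')"
proof -
  let ?r = "(Restr E (X - C'))\<^sup>*"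
  have s: "s \<in> X" "s \<notin> C'" using X C' by (auto simp: component_of_def)
  \<comment> \<open>A neighbour of \<open>C'\<close> in \<open>C - S\<close> belongs to
    \<open>C'\<close>, so a vertex of \<open>X\<close> outside \<open>C'\<close> that is adjacent to
    \<open>C'\<close> lies in \<open>S\<close>, and \<open>s\<close> is the only such vertex of
    \<open>X\<close>.\<close>
  have eq: "y = s" if "y \<in> X" "y \<notin> C'" "z \<in> C'" "(y, z) \<in> E" for y z
  proof (rule ccontr)
    assume "y \<noteq> s"
    then have "y \<in> C - S - C'" using that X by blast
    moreover have "(z, y) \<in> E" using that symD[OF E] by blast
    ultimately show False using that C' unfolding component_of_def touching_def by blast
  qed
  have "(s, x) \<in> ?r" if "x \<in> X" "x \<notin> C'" for x
  proof -
    have "(s, x) \<in> (Restr E X)\<^sup>*" using connected_onD[OF X(1) s(1) that(1)] .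
    \<comment> \<open>Nothing is recorded while the walk is in \<open>C'\<close>; on leaving
      \<open>C'\<close> it is back at \<open>s\<close>, which is reachable trivially.\<close>
    then have "x \<in> C' \<or> (s, x) \<in> ?r"
    proof induct
      case (step y z)
      show ?case
      proof (cases "z \<in> C'")
        case False
        show ?thesis
        proof (cases "y \<in> C'")
          case True
          then have "z = s" using eq[of z y] False step(2) symD[OF E] by blast
          then show ?thesis by simp
        next
          case ynC: False
          then have "(y, z) \<in> Restr E (X - C')" using False step by auto
          then show ?thesis using ynC step by (auto intro: rtrancl_into_rtrancl)
        qed
      qed simp
    qed simp
    then show ?thesis using that by simp
  qed
  then show ?thesis by (intro connected_on_rootI[OF E, of s]) (use s in auto)
qed

section \<open>The Helly property of subtrees\<close>

text \<open>A leaf order: each new vertex has at most one earlier neighbour, namely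
  \<open>p\<close>. The induction rule then amounts to removing a leaf.\<close>

inductive leaf_built :: "'a rel \<Rightarrow> 'a set \<Rightarrow> bool" for E where
  root: "leaf_built E {r}"
| leaf: "leaf_built E W \<Longrightarrow> v \<notin> W \<Longrightarrow> p \<in> W \<Longrightarrow> (\<And>q. q \<in> W \<Longrightarrow> (v, q) \<in> E \<Longrightarrow> q = p) \<Longrightarrow>
    leaf_built E (insert v W)"

text \<open>A walk in \<open>X\<close> through the leaf \<open>v\<close> enters and leaves it at
  \<open>p\<close>, so the detour can be cut out.\<close>

lemma connected_on_minus_leaf:
  assumes E: "sym E" and X: "connected_on E X" "X \<noteq> {v}"
    and p: "p \<noteq> v" "\<And>q. q \<in> X - {v} \<Longrightarrow> (v, q) \<in> E \<Longrightarrow> q = p"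
  shows "connected_on E (X - {v})" "v \<in> X \<Longrightarrow> p \<in> X"
proof -
  show px: "p \<in> X" if "v \<in> X"
    using connected_on_crossing[OF X(1), of "{v}"] X(2) that p by (auto simp: touching_def)
  let ?r = "(Restr E (X - {v}))\<^sup>*"
  show "connected_on E (X - {v})"
  proof (cases "v \<in> X")
    case True
    have "(p, x) \<in> ?r" if "x \<in> X" "x \<noteq> v" for x
    proof -
      have "(p, x) \<in> (Restr E X)\<^sup>*" using connected_onD[OF X(1) px[OF True] that(1)] .
      then have "x = v \<or> (p, x) \<in> ?r"
      proof induct
        case (step y z)
        show ?case
        proof (cases "y = v \<or> z = v")
          case True
          then show ?thesis using p(2)[of z] step by auto
        next
          case False
          then have "(y, z) \<in> Restr E (X - {v})" using step by auto
          then show ?thesis using False step by (auto intro: rtrancl_into_rtrancl)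
        qed
      qed simp
      then show ?thesis using that by simp
    qed
    then show ?thesis by (intro connected_on_rootI[OF E, of p]) (use px True p in auto)
  qed (use X in simp)
qed

text \<open>Induction over the leaf order. If \<open>{v}\<close> belongs to \<open>F\<close>, then
  \<open>v\<close> lies in every member. Otherwise deleting the leaf \<open>v\<close> keeps all
  members connected, and two members that met in \<open>v\<close> still meet in
  \<open>p\<close>.\<close>

lemma leaf_built_Helly:
  assumes "leaf_built E W" "sym E" "\<And>X. X \<in> F \<Longrightarrow> X \<subseteq> W \<and> connected_on E X"
    "\<And>X Y. X \<in> F \<Longrightarrow> Y \<in> F \<Longrightarrow> X \<inter> Y \<noteq> {}"
  shows "\<exists>x\<in>W. \<forall>X\<in>F. x \<in> X"
  using assms(1,3,4)
proof (induct arbitrary: F)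
  case (root r)
  then show ?case using connected_on_not_empty by (metis insertI1 subset_singletonD)
next
  case (leaf W v p)
  show ?case
  proof (cases "{v} \<in> F")
    case True
    then show ?thesis using leaf.prems(2) by fastforce
  next
    case False
    have pv: "p \<noteq> v" using leaf by auto
    have conn: "connected_on E (X - {v})" "v \<in> X \<Longrightarrow> p \<in> X" if "X \<in> F" for X
      using connected_on_minus_leaf[OF assms(2), of X v p] leaf.prems(1)[OF that] leaf.hyps(5) pv
        False that by blast+
    have "\<exists>x\<in>W. \<forall>X\<in>(\<lambda>X. X - {v}) ` F. x \<in> X"
    proof (rule leaf.hyps(2))
      fix X assume "X \<in> (\<lambda>X. X - {v}) ` F"
      then show "X \<subseteq> W \<and> connected_on E X" using leaf.prems(1) conn(1) by blast
    next
      fix X Y assume "X \<in> (\<lambda>X. X - {v}) ` F" "Y \<in> (\<lambda>X. X - {v}) ` F"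
      then obtain X' Y' where XY: "X' \<in> F" "Y' \<in> F" "X = X' - {v}" "Y = Y' - {v}" by blast
      then obtain z where "z \<in> X'" "z \<in> Y'" using leaf.prems(2) by blast
      then have "\<exists>z. z \<noteq> v \<and> z \<in> X' \<and> z \<in> Y'"
        using conn(2)[OF XY(1)] conn(2)[OF XY(2)] pv by metis
      then show "X \<inter> Y \<noteq> {}" using XY(3,4) by blast
    qed
    then show ?thesis by auto
  qed
qed

section \<open>Clique models and separators\<close>

text \<open>The branch sets of a complete minor, indexed by \<open>I\<close>. In the construction
  the indices are the numbers of parts.\<close>

definition clique_model :: "'a rel \<Rightarrow> 'i set \<Rightarrow> ('i \<Rightarrow> 'a set) \<Rightarrow> bool" where
  "clique_model E I A \<longleftrightarrow> (\<forall>i\<in>I. connected_on E (A i)) \<and>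
     (\<forall>i\<in>I. \<forall>j\<in>I. i \<noteq> j \<longrightarrow> A i \<inter> A j = {} \<and> touching E (A i) (A j))"

lemma clique_model_insertI:
  assumes "sym E" "n \<notin> I" "clique_model E I A" "connected_on E D"
    and D: "\<And>i. i \<in> I \<Longrightarrow> A i \<inter> D = {} \<and> touching E (A i) D"
  shows "clique_model E (insert n I) (A(n := D))"
  unfolding clique_model_def
proof (intro conjI ballI impI)
  fix i assume "i \<in> insert n I"
  then show "connected_on E ((A(n := D)) i)"
    using assms(3,4) by (auto simp: clique_model_def)
next
  fix i j assume ij: "i \<in> insert n I" "j \<in> insert n I" "i \<noteq> j"
  then consider "i = n" "j \<in> I" | "j = n" "i \<in> I" | "i \<in> I" "j \<in> I" "i \<noteq> n" "j \<noteq> n" by blast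
  then have "(A(n := D)) i \<inter> (A(n := D)) j = {} \<and> touching E ((A(n := D)) i) ((A(n := D)) j)"
  proof cases
    case 1
    then show ?thesis
      using D[of j] touching_commute[OF assms(1), of D "A j"] ij(3) by (simp add: Int_commute)
  next
    case 2
    then show ?thesis using D[of i] ij(3) by simp
  next
    case 3
    then show ?thesis using assms(3) ij(3) by (simp add: clique_model_def)
  qed
  then show "(A(n := D)) i \<inter> (A(n := D)) j = {}" "touching E ((A(n := D)) i) ((A(n := D)) j)"
    by simp_all
qed

text \<open>\<open>C\<close> could serve as one more branch set; it is kept apart because it is the
  piece still to be divided.\<close>

definition rooted_clique_model :: "'a rel \<Rightarrow> 'i set \<Rightarrow> ('i \<Rightarrow> 'a set) \<Rightarrow> 'a set \<Rightarrow> bool" where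
  "rooted_clique_model E I A C \<longleftrightarrow> clique_model E I A \<and> connected_on E C \<and>
     (\<forall>i\<in>I. A i \<inter> C = {} \<and> touching E (A i) C)"

text \<open>The only form in which treewidth enters the construction: for treewidth
  \<open>m - 1\<close> the set \<open>B\<close> is a bag.\<close>

definition hitting_bound :: "'a rel \<Rightarrow> 'a set \<Rightarrow> nat \<Rightarrow> bool" where
  "hitting_bound E V m \<longleftrightarrow> (\<forall>F. (\<forall>X\<in>F. X \<subseteq> V \<and> connected_on E X) \<and> (\<forall>X\<in>F. \<forall>Y\<in>F. X \<inter> Y \<noteq> {}) \<longrightarrow>
     (\<exists>B. finite B \<and> card B \<le> m \<and> (\<forall>X\<in>F. X \<inter> B \<noteq> {})))"

lemma hitting_bound_mono:
  assumes "hitting_bound E V m" "C \<subseteq> V"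
  shows "hitting_bound E C m"
  unfolding hitting_bound_def
proof (intro allI impI)
  fix F assume F: "(\<forall>X\<in>F. X \<subseteq> C \<and> connected_on E X) \<and> (\<forall>X\<in>F. \<forall>Y\<in>F. X \<inter> Y \<noteq> {})"
  then have "\<forall>X\<in>F. X \<subseteq> V \<and> connected_on E X" using assms(2) by fast
  with F show "\<exists>B. finite B \<and> card B \<le> m \<and> (\<forall>X\<in>F. X \<inter> B \<noteq> {})"
    using assms(1)[unfolded hitting_bound_def, rule_format, of F] by simp
qed

definition clique_minor_bound :: "'a rel \<Rightarrow> 'a set \<Rightarrow> nat \<Rightarrow> bool" where
  "clique_minor_bound E V t \<longleftrightarrow>
     (\<forall>(I :: nat set) A. finite I \<and> clique_model E I A \<and> (\<forall>i\<in>I. A i \<subseteq> V) \<longrightarrow> card I < t)"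

lemma minimal_hitting_set:
  assumes "finite C" "finite B" "\<And>X. X \<in> F \<Longrightarrow> X \<subseteq> C \<and> X \<inter> B \<noteq> {}"
  obtains S where "S \<subseteq> C" "card S \<le> card B" "\<And>X. X \<in> F \<Longrightarrow> X \<inter> S \<noteq> {}"
    "\<And>s. s \<in> S \<Longrightarrow> \<exists>X\<in>F. X \<inter> S = {s}"
proof -
  let ?P = "\<lambda>S. S \<subseteq> C \<and> (\<forall>X\<in>F. X \<inter> S \<noteq> {})"
  have P: "?P (B \<inter> C)" using assms(3) by blast
  then obtain S where S: "?P S" and min: "\<And>S'. ?P S' \<Longrightarrow> card S \<le> card S'"
    using ex_has_least_nat[of ?P "B \<inter> C" card] by blast
  have fin: "finite S" using S assms(1) finite_subset by blast
  show thesis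
  proof
    show "S \<subseteq> C" "\<And>X. X \<in> F \<Longrightarrow> X \<inter> S \<noteq> {}" using S by auto
    show "card S \<le> card B" using min[OF P] card_mono[OF assms(2), of "B \<inter> C"] by simp
    fix s assume s: "s \<in> S"
    have "\<not> ?P (S - {s})"
    proof
      assume "?P (S - {s})"
      then have "card S \<le> card (S - {s})" by (rule min)
      then show False using card_Diff1_less[OF fin s] by simp
    qed
    then obtain X where X: "X \<in> F" "X \<inter> (S - {s}) = {}" using S by auto
    then have "X \<inter> S = {s}" using S s by blast
    with X show "\<exists>X\<in>F. X \<inter> S = {s}" by blast
  qed
qed

text \<open>One set \<open>S\<close> serves all components \<open>C'\<close>, whereas the branch set
  \<open>D\<close> around it depends on \<open>C'\<close>. \<open>D\<close> may swallow an old
  \<open>A k\<close>, but only one that does not touch \<open>C'\<close>, whose index is then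
  discarded.\<close>

lemma separator_step:
  assumes E: "sym E" and fin: "finite C" and mod: "rooted_clique_model E I A C" and n: "n \<notin> I"
    and hit: "hitting_bound E C m"
  obtains S where "S \<subseteq> C" "S \<noteq> {}" "card S \<le> m"
    "\<And>C'. component_of E (C - S) C' \<Longrightarrow> \<exists>D. S \<subseteq> D \<and> D \<subseteq> C \<union> (\<Union>i\<in>I. A i) \<and>
       rooted_clique_model E (insert n {i \<in> I. touching E (A i) C'}) (A(n := D)) C'"
proof -
  have C: "connected_on E C" using mod by (simp add: rooted_clique_model_def)
  have A: "connected_on E (A i)" "A i \<inter> C = {}" "touching E (A i) C" if "i \<in> I" for i
    using mod that by (auto simp: rooted_clique_model_def clique_model_def)
  have AA: "A i \<inter> A j = {}" "touching E (A i) (A j)" if "i \<in> I" "j \<in> I" "i \<noteq> j" for i j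
    using mod that by (auto simp: rooted_clique_model_def clique_model_def)
  text \<open>\<open>F'\<close> is pairwise intersecting, and a component of \<open>C - S\<close> that still touches every \<open>A i\<close> is
    disjoint from some member of \<open>F\<close>, because \<open>S\<close> hits all of \<open>F'\<close>.\<close>
  define F where "F = {X. X \<subseteq> C \<and> connected_on E X \<and> (\<forall>i\<in>I. touching E (A i) X)}"
  define F' where "F' = {X \<in> F. \<forall>Y\<in>F. X \<inter> Y \<noteq> {}}"
  \<comment> \<open>\<open>C\<close> meets every member of \<open>F\<close>, these being nonempty
    subsets of \<open>C\<close>. So \<open>F'\<close> is not empty, which later forces
    \<open>S\<close> to be nonempty.\<close>
  have CF': "C \<in> F'"
    using C A(3) connected_on_not_empty by (fastforce simp: F'_def F_def)
  obtain B where B: "finite B" "card B \<le> m" "\<And>X. X \<in> F' \<Longrightarrow> X \<inter> B \<noteq> {}"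
  proof -
    have "\<exists>B. finite B \<and> card B \<le> m \<and> (\<forall>X\<in>F'. X \<inter> B \<noteq> {})"
      using hit[unfolded hitting_bound_def, rule_format, of F'] by (auto simp: F'_def F_def)
    then show thesis using that by blast
  qed
  have F'C: "X \<subseteq> C" if "X \<in> F'" for X using that by (simp add: F'_def F_def)
  obtain S where S: "S \<subseteq> C" "card S \<le> card B" "\<And>X. X \<in> F' \<Longrightarrow> X \<inter> S \<noteq> {}"
    and crit: "\<And>s. s \<in> S \<Longrightarrow> \<exists>X\<in>F'. X \<inter> S = {s}"
    using minimal_hitting_set[OF fin B(1), of F'] B(3) F'C by metis
  from crit obtain P where P: "\<And>s. s \<in> S \<Longrightarrow> P s \<in> F'" "\<And>s. s \<in> S \<Longrightarrow> P s \<inter> S = {s}" by metis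
  have ne: "S \<noteq> {}" using S(3)[OF CF'] by blast
  show thesis
  proof
    show "S \<subseteq> C" "S \<noteq> {}" "card S \<le> m" using S B(2) ne by auto
    fix C' assume C': "component_of E (C - S) C'"
    then have C'1: "connected_on E C'" "C' \<subseteq> C" "C' \<inter> S = {}" "C' \<noteq> {}"
      by (auto simp: component_of_def connected_on_def)
    define I' where "I' = {i \<in> I. touching E (A i) C'}"
    have conn: "connected_on E (P s - C')" if "s \<in> S" for s
      by (rule connected_on_minus_component[OF E _ _ P(2)[OF that] C'])
        (use P(1)[OF that] in \<open>auto simp: F'_def F_def\<close>)
    text \<open>\<open>K\<close> is the seed of the branch set of \<open>S\<close>; by minimality of \<open>S\<close>, every \<open>s \<in> S\<close> is joined to it
      inside \<open>P s - C'\<close>.\<close>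
    obtain K where K: "connected_on E K" "K \<subseteq> C \<union> (\<Union>i\<in>I. A i)" "K \<inter> C' = {}"
      and KI: "\<And>i. i \<in> I' \<Longrightarrow> K \<inter> A i = {} \<and> touching E (A i) K"
      and KP: "\<And>s. s \<in> S \<Longrightarrow> (P s - C') \<inter> K \<noteq> {} \<or> touching E (P s - C') K"
    proof (cases "I' = I")
      case True
      then have "C' \<in> F" using C'1 by (auto simp: F_def I'_def)
      moreover have "C' \<notin> F'" using S(3) C'1 by blast
      ultimately obtain Y where Y: "Y \<in> F" "C' \<inter> Y = {}" by (auto simp: F'_def)
      have "(P s - C') \<inter> Y \<noteq> {}" if "s \<in> S" for s
        using P(1)[OF that] Y by (auto simp: F'_def)
      moreover have "connected_on E Y" "Y \<subseteq> C" "\<forall>i\<in>I. touching E (A i) Y"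
        using Y(1) by (auto simp: F_def)
      ultimately show thesis using Y(2) A(2) True by (intro that[of Y]) blast+
    next
      case False
      then obtain k where k: "k \<in> I" "\<not> touching E (A k) C'" by (auto simp: I'_def)
      \<comment> \<open>\<open>P s\<close> touches \<open>A k\<close>, and the contact cannot lie in
        \<open>C'\<close>, so removing \<open>C'\<close> preserves it.\<close>
      have "touching E (P s - C') (A k)" if "s \<in> S" for s
      proof -
        have "touching E (A k) (P s)" using P(1)[OF that] k by (auto simp: F'_def F_def)
        then have "touching E (A k) (P s - C')" using k(2) by (auto simp: touching_def)
        then show ?thesis using touching_commute[OF E] by blast
      qed
      moreover have "A k \<inter> A i = {} \<and> touching E (A i) (A k)" if "i \<in> I'" for i
      proof -
        have "i \<in> I" "i \<noteq> k" using that k by (auto simp: I'_def)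
        then show ?thesis using AA k(1) by blast
      qed
      ultimately show thesis using A(1,2)[OF k(1)] k(1) C'1(2) by (intro that[of "A k"]) blast+
    qed
    \<comment> \<open>Each piece includes the seed \<open>K\<close>, so all pieces share a vertex
      and their union is connected. Since \<open>S\<close> is nonempty, \<open>K\<close> lies in
      \<open>D\<close>.\<close>
    define D where "D = (\<Union>s\<in>S. (P s - C') \<union> K)"
    have PC: "P s \<subseteq> C" if "s \<in> S" for s using F'C[OF P(1)[OF that]] .
    obtain a where a: "a \<in> K" using connected_on_not_empty[OF K(1)] by blast
    have D1: "connected_on E D" unfolding D_def
      by (rule connected_on_UN[OF E ne, where a = a])
        (use a conn KP K(1) in \<open>auto intro!: connected_on_Un[OF E]\<close>)
    have D2: "S \<subseteq> D" using P(2) C'1(3) by (force simp: D_def)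
    have D3: "D \<subseteq> C \<union> (\<Union>i\<in>I. A i)" using PC K(2) unfolding D_def by blast
    have KD: "K \<subseteq> D" using ne by (auto simp: D_def)
    have D4: "D \<inter> C' = {}" using K(3) by (auto simp: D_def)
    have D5: "A i \<inter> D = {} \<and> touching E (A i) D" if "i \<in> I'" for i
    proof
      have "i \<in> I" using that by (simp add: I'_def)
      then show "A i \<inter> D = {}" using KI[OF that] PC A(2) unfolding D_def by blast
      show "touching E (A i) D" using KI[OF that] touching_mono[OF _ subset_refl KD] by blast
    qed
    \<comment> \<open>\<open>C\<close> is connected and \<open>C'\<close> is a proper subset, so
      \<open>C'\<close> has a neighbour in \<open>C - C'\<close>. It cannot lie in
      \<open>C - S\<close>, hence it lies in \<open>S\<close>.\<close>
    have D6: "touching E D C'"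
    proof -
      have "C' \<noteq> C" using C'1 S(1) ne by blast
      then have "touching E C' (C - C')" using connected_on_crossing[OF C C'1(2) C'1(4)] by blast
      moreover have "\<not> touching E C' (C - S - C')" using C' by (simp add: component_of_def)
      ultimately have "touching E C' S" by (auto simp: touching_def)
      then show ?thesis using D2 touching_commute[OF E] touching_mono by blast
    qed
    have "clique_model E I' A" using mod by (auto simp: rooted_clique_model_def clique_model_def I'_def)
    then have "clique_model E (insert n I') (A(n := D))"
      by (intro clique_model_insertI[OF E]) (use n D1 D5 in \<open>auto simp: I'_def\<close>)
    moreover have "(A(n := D)) i \<inter> C' = {} \<and> touching E ((A(n := D)) i) C'" if "i \<in> insert n I'" for i
      using that D4 D6 n A(2)[of i] C'1(2) by (auto simp: I'_def)
    ultimately have "rooted_clique_model E (insert n I') (A(n := D)) C'"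
      using C'1(1) by (simp add: rooted_clique_model_def)
    then show "\<exists>D. S \<subseteq> D \<and> D \<subseteq> C \<union> (\<Union>i\<in>I. A i) \<and>
       rooted_clique_model E (insert n {i \<in> I. touching E (A i) C'}) (A(n := D)) C'"
      using D2 D3 unfolding I'_def by blast
  qed
qed

section \<open>Choosing the parts one at a time\<close>

text \<open>The vertices outside \<open>R\<close> have been distributed over the parts \<open>0, \<dots>, n - 1\<close>; part \<open>j\<close> is
  joined to the earlier parts in \<open>N j\<close>. Every component of \<open>R\<close> only sees parts that are
  pairwise joined and that extend to a clique model avoiding this component.\<close>

definition partial_partition ::
  "'a rel \<Rightarrow> 'a set \<Rightarrow> nat \<Rightarrow> nat \<Rightarrow> nat \<Rightarrow> 'a set \<Rightarrow> ('a \<Rightarrow> nat) \<Rightarrow> (nat \<Rightarrow> nat set) \<Rightarrow> bool" where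
  "partial_partition E V m t n R f N \<longleftrightarrow> R \<subseteq> V \<and>
     (\<forall>v\<in>V - R. f v < n) \<and>
     (\<forall>j<n. N j \<subseteq> {..<j} \<and> card (N j) + 2 \<le> t \<and> (\<forall>a\<in>N j. \<forall>b\<in>N j. a < b \<longrightarrow> a \<in> N b)) \<and>
     (\<forall>j<n. card {v \<in> V - R. f v = j} \<le> m) \<and>
     (\<forall>u\<in>V - R. \<forall>v\<in>V - R. (u, v) \<in> E \<longrightarrow> f u = f v \<or> f u \<in> N (f v) \<or> f v \<in> N (f u)) \<and>
     (\<forall>C. component_of E R C \<longrightarrow>
       (\<exists>I A. I \<subseteq> {..<n} \<and> (\<forall>a\<in>I. \<forall>b\<in>I. a < b \<longrightarrow> a \<in> N b) \<and>
          rooted_clique_model E I A C \<and> (\<forall>i\<in>I. A i \<subseteq> V) \<and>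
          (\<forall>c\<in>C. \<forall>v\<in>V - R. (c, v) \<in> E \<longrightarrow> f v \<in> I \<and> v \<in> A (f v))))"

text \<open>No arc joins \<open>C\<close> to the rest of \<open>R\<close>. So a component of
  \<open>R - S\<close> that meets \<open>C\<close> stays inside it, and one that misses
  \<open>C\<close> was a component of \<open>R\<close> already.\<close>

lemma component_of_minus:
  assumes "sym E" "component_of E R C" "S \<subseteq> C" "component_of E (R - S) C'"
  shows "component_of E (C - S) C' \<or> component_of E R C' \<and> C' \<inter> C = {}"
proof (cases "C' \<inter> C = {}")
  case True
  have "\<not> touching E C' C"
  proof
    assume "touching E C' C"
    then have "touching E C C'" using touching_commute[OF assms(1)] by blast
    moreover have "C' \<subseteq> R - C" using True assms(4) by (auto simp: component_of_def)
    ultimately show False using assms(2) touching_mono by (fastforce simp: component_of_def)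
  qed
  then have "\<not> touching E C' (R - C')"
    using assms(3,4) unfolding component_of_def touching_def by blast
  then show ?thesis using True assms(4) by (auto simp: component_of_def)
next
  case False
  have "C' \<subseteq> C"
  proof (rule ccontr)
    assume "\<not> C' \<subseteq> C"
    then have "touching E (C' \<inter> C) (C' - C' \<inter> C)"
      using False assms(4) by (intro connected_on_crossing) (auto simp: component_of_def)
    then have "touching E C (R - C)"
      by (rule touching_mono) (use assms(4) in \<open>auto simp: component_of_def\<close>)
    then show False using assms(2) by (simp add: component_of_def)
  qed
  then show ?thesis using assms(2,4) by (auto simp: component_of_def touching_def)
qed

text \<open>The separator \<open>S\<close> of one component \<open>C\<close> becomes part
  \<open>n\<close>, with the parts seen by \<open>C\<close> among its earlier neighbours
  \<open>I\<close>.\<close>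

lemma partial_partition_step:
  assumes E: "sym E" and fin: "finite V" and hit: "hitting_bound E V m"
    and small: "clique_minor_bound E V t"
    and st: "partial_partition E V m t n R f N" and R: "R \<noteq> {}"
  obtains S f' N' where "S \<subseteq> R" "S \<noteq> {}" "partial_partition E V m t (Suc n) (R - S) f' N'"
proof -
  have RV: "R \<subseteq> V"
    using st unfolding partial_partition_def by (elim conjE)
  have "\<forall>v\<in>V - R. f v < n"
    using st unfolding partial_partition_def by (elim conjE)
  then have f: "f v < n" if "v \<in> V - R" for v using that by blast
  have "\<forall>j<n. N j \<subseteq> {..<j} \<and> card (N j) + 2 \<le> t \<and> (\<forall>a\<in>N j. \<forall>b\<in>N j. a < b \<longrightarrow> a \<in> N b)"
    using st unfolding partial_partition_def by (elim conjE)
  then have N: "N j \<subseteq> {..<j}" "card (N j) + 2 \<le> t" "\<forall>a\<in>N j. \<forall>b\<in>N j. a < b \<longrightarrow> a \<in> N b"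
    if "j < n" for j using that by simp_all
  have parts: "\<forall>j<n. card {v \<in> V - R. f v = j} \<le> m"
    using st unfolding partial_partition_def by (elim conjE)
  have edges: "\<forall>u\<in>V - R. \<forall>v\<in>V - R. (u, v) \<in> E \<longrightarrow> f u = f v \<or> f u \<in> N (f v) \<or> f v \<in> N (f u)"
    using st unfolding partial_partition_def by (elim conjE)
  have comp: "\<forall>C. component_of E R C \<longrightarrow>
       (\<exists>I A. I \<subseteq> {..<n} \<and> (\<forall>a\<in>I. \<forall>b\<in>I. a < b \<longrightarrow> a \<in> N b) \<and>
          rooted_clique_model E I A C \<and> (\<forall>i\<in>I. A i \<subseteq> V) \<and>
          (\<forall>c\<in>C. \<forall>v\<in>V - R. (c, v) \<in> E \<longrightarrow> f v \<in> I \<and> v \<in> A (f v)))"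
    using st unfolding partial_partition_def by (elim conjE)
  obtain C where C: "component_of E R C" using R component_of_exists[OF E] by blast
  then have CR: "C \<subseteq> R" by (simp add: component_of_def)
  obtain I A where I1: "I \<subseteq> {..<n}" and I2: "\<forall>a\<in>I. \<forall>b\<in>I. a < b \<longrightarrow> a \<in> N b"
    and mod: "rooted_clique_model E I A C" and AV: "\<forall>i\<in>I. A i \<subseteq> V"
    and nb: "\<forall>c\<in>C. \<forall>v\<in>V - R. (c, v) \<in> E \<longrightarrow> f v \<in> I \<and> v \<in> A (f v)"
    using comp[rule_format, OF C] by (elim exE conjE) (rule that)
  note I = I1 I2[rule_format]
  have nI: "n \<notin> I" using I(1) by auto
  have finI: "finite I" using I(1) finite_subset by blast
  \<comment> \<open>With \<open>C\<close> as an additional branch set the model has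
    \<open>card I + 1\<close> members, which must be fewer than \<open>t\<close>.\<close>
  have cardI: "card I + 2 \<le> t"
  proof -
    have "clique_model E (insert n I) (A(n := C))"
      by (rule clique_model_insertI[OF E nI]) (use mod in \<open>auto simp: rooted_clique_model_def\<close>)
    moreover have "\<forall>i\<in>insert n I. (A(n := C)) i \<subseteq> V" using CR RV AV by auto
    ultimately have "card (insert n I) < t"
      using small finI unfolding clique_minor_bound_def by blast
    then show ?thesis using nI finI by simp
  qed
  have finC: "finite C" by (rule finite_subset[OF _ fin]) (use CR RV in blast)
  have hitC: "hitting_bound E C m"
    using hitting_bound_mono[OF hit] CR RV by blast
  obtain S where S: "S \<subseteq> C" "S \<noteq> {}" "card S \<le> m"
    and step: "\<And>C'. component_of E (C - S) C' \<Longrightarrow> \<exists>D. S \<subseteq> D \<and> D \<subseteq> C \<union> (\<Union>i\<in>I. A i) \<and>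
       rooted_clique_model E (insert n {i \<in> I. touching E (A i) C'}) (A(n := D)) C'"
    by (rule separator_step[OF E finC mod nI hitC]) (rule that)
  define f' where "f' v = (if v \<in> S then n else f v)" for v
  define N' where "N' = N(n := I)"
  have VR: "V - (R - S) = (V - R) \<union> S" "S \<inter> (V - R) = {}" using S CR RV by auto
  have f'1: "f' v = n" if "v \<in> S" for v using that by (simp add: f'_def)
  have f'2: "f' v = f v" if "v \<in> V - R" for v using that VR(2) by (auto simp: f'_def)
  have N'n: "N' n = I" by (simp add: N'_def)
  have N'j: "N' j = N j" if "j < n" for j using that by (simp add: N'_def)
  have "partial_partition E V m t (Suc n) (R - S) f' N'"
    unfolding partial_partition_def
  proof (intro conjI)
    show "R - S \<subseteq> V" using RV by blast
    show "\<forall>v\<in>V - (R - S). f' v < Suc n"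
      unfolding VR(1) using f f'1 f'2 by (auto simp: less_SucI)
    show "\<forall>j<Suc n. N' j \<subseteq> {..<j} \<and> card (N' j) + 2 \<le> t \<and>
        (\<forall>a\<in>N' j. \<forall>b\<in>N' j. a < b \<longrightarrow> a \<in> N' b)"
    proof (intro allI impI)
      fix j assume "j < Suc n"
      then consider "j < n" | "j = n" by linarith
      then show "N' j \<subseteq> {..<j} \<and> card (N' j) + 2 \<le> t \<and> (\<forall>a\<in>N' j. \<forall>b\<in>N' j. a < b \<longrightarrow> a \<in> N' b)"
      proof cases
        case 1
        have "b < n" if "b \<in> N j" for b using N[OF 1] that 1 by auto
        then show ?thesis using N[OF 1] 1 by (auto simp: N'j)
      next
        case 2
        have "b < n" if "b \<in> I" for b using I(1) that by auto
        then show ?thesis using I cardI 2 by (auto simp: N'j N'n)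
      qed
    qed
    show "\<forall>j<Suc n. card {v \<in> V - (R - S). f' v = j} \<le> m"
    proof (intro allI impI)
      fix j assume "j < Suc n"
      then consider "j < n" | "j = n" by linarith
      then show "card {v \<in> V - (R - S). f' v = j} \<le> m"
      proof cases
        case 1
        then have "{v \<in> V - (R - S). f' v = j} = {v \<in> V - R. f v = j}"
          unfolding VR(1) using f'1 f'2 by auto
        then show ?thesis using parts 1 by simp
      next
        case 2
        then have "{v \<in> V - (R - S). f' v = j} = S"
          unfolding VR(1) using f'1 f'2 f by fastforce
        then show ?thesis using S by simp
      qed
    qed
    show "\<forall>u\<in>V - (R - S). \<forall>v\<in>V - (R - S). (u, v) \<in> E \<longrightarrow>
        f' u = f' v \<or> f' u \<in> N' (f' v) \<or> f' v \<in> N' (f' u)"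
    proof (intro ballI impI)
      fix u v assume uv: "u \<in> V - (R - S)" "v \<in> V - (R - S)" "(u, v) \<in> E"
      then have vu: "(v, u) \<in> E" using E by (simp add: symD)
      consider "u \<in> S" "v \<in> S" | "u \<in> S" "v \<in> V - R" | "u \<in> V - R" "v \<in> S" | "u \<in> V - R" "v \<in> V - R"
        using uv unfolding VR(1) by blast
      then show "f' u = f' v \<or> f' u \<in> N' (f' v) \<or> f' v \<in> N' (f' u)"
      proof cases
        case 1 then show ?thesis by (simp add: f'1)
      next
        \<comment> \<open>An end in \<open>S\<close> lies in \<open>C\<close>, so \<open>nb\<close>
          places the part of the other end in \<open>I\<close>, the neighbourhood of part
          \<open>n\<close>.\<close>
        case 2 then show ?thesis using nb[rule_format, of u v] uv(3) S(1) by (auto simp: f'1 f'2 N'n)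
      next
        case 3 then show ?thesis using nb[rule_format, of v u] vu S(1) by (auto simp: f'1 f'2 N'n)
      next
        case 4 then show ?thesis using edges[rule_format, OF 4 uv(3)] f by (auto simp: f'2 N'j)
      qed
    qed
    show "\<forall>C'. component_of E (R - S) C' \<longrightarrow>
       (\<exists>I A. I \<subseteq> {..<Suc n} \<and> (\<forall>a\<in>I. \<forall>b\<in>I. a < b \<longrightarrow> a \<in> N' b) \<and>
          rooted_clique_model E I A C' \<and> (\<forall>i\<in>I. A i \<subseteq> V) \<and>
          (\<forall>c\<in>C'. \<forall>v\<in>V - (R - S). (c, v) \<in> E \<longrightarrow> f' v \<in> I \<and> v \<in> A (f' v)))"
    proof (intro allI impI)
      fix C' assume C': "component_of E (R - S) C'"
      consider "component_of E (C - S) C'" | "component_of E R C'" "C' \<inter> C = {}"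
        using component_of_minus[OF E C S(1) C'] by blast
      then show "\<exists>I A. I \<subseteq> {..<Suc n} \<and> (\<forall>a\<in>I. \<forall>b\<in>I. a < b \<longrightarrow> a \<in> N' b) \<and>
          rooted_clique_model E I A C' \<and> (\<forall>i\<in>I. A i \<subseteq> V) \<and>
          (\<forall>c\<in>C'. \<forall>v\<in>V - (R - S). (c, v) \<in> E \<longrightarrow> f' v \<in> I \<and> v \<in> A (f' v))"
      proof cases
        case 1
        let ?I = "{i \<in> I. touching E (A i) C'}"
        obtain D where D: "S \<subseteq> D" "D \<subseteq> C \<union> (\<Union>i\<in>I. A i)"
          "rooted_clique_model E (insert n ?I) (A(n := D)) C'"
          using step[OF 1] by blast
        have ltn: "i < n" if "i \<in> I" for i using that I(1) by auto
        have "C \<union> (\<Union>i\<in>I. A i) \<subseteq> V" using AV CR RV by (simp add: UN_least subset_trans[of C R V])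
        then have DV: "D \<subseteq> V" using D(2) by (rule subset_trans[rotated])
        have "insert n ?I \<subseteq> {..<Suc n}" using ltn by (auto simp: less_SucI)
        moreover have "\<forall>a\<in>insert n ?I. \<forall>b\<in>insert n ?I. a < b \<longrightarrow> a \<in> N' b"
          using ltn I(2) by (auto simp: N'n N'j dest: less_asym)
        moreover have "\<forall>i\<in>insert n ?I. (A(n := D)) i \<subseteq> V" using DV AV by simp
        moreover have "\<forall>c\<in>C'. \<forall>v\<in>V - (R - S). (c, v) \<in> E \<longrightarrow>
          f' v \<in> insert n ?I \<and> v \<in> (A(n := D)) (f' v)"
        proof (intro ballI impI)
          fix c v assume c: "c \<in> C'" and v: "v \<in> V - (R - S)" and cv: "(c, v) \<in> E"
          show "f' v \<in> insert n ?I \<and> v \<in> (A(n := D)) (f' v)"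
          proof (cases "v \<in> S")
            case True then show ?thesis using D(1) by (auto simp: f'1)
          next
            case False
            then have v': "v \<in> V - R" using v by blast
            have "c \<in> C" using c 1 by (auto simp: component_of_def)
            then have fv: "f v \<in> I" "v \<in> A (f v)" using nb[rule_format, OF _ v' cv] by auto
            \<comment> \<open>The arc from \<open>c\<close> to \<open>v\<close> itself witnesses the
              contact, so restricting \<open>I\<close> to \<open>?I\<close> loses no part seen by
              \<open>C'\<close>.\<close>
            moreover have "touching E (A (f v)) C'"
              using fv(2) c symD[OF E cv] by (auto simp: touching_def)
            ultimately show ?thesis using nI by (auto simp: f'2[OF v'])
          qed
        qed
        ultimately show ?thesis using D(3)
          by (intro exI[of _ "insert n ?I"] exI[of _ "A(n := D)"] conjI)
      next
        case 2
        obtain J B where J: "J \<subseteq> {..<n}" "\<forall>a\<in>J. \<forall>b\<in>J. a < b \<longrightarrow> a \<in> N b"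
          "rooted_clique_model E J B C'" "\<forall>i\<in>J. B i \<subseteq> V"
          and nbJ: "\<forall>c\<in>C'. \<forall>v\<in>V - R. (c, v) \<in> E \<longrightarrow> f v \<in> J \<and> v \<in> B (f v)"
          using comp[rule_format, OF 2(1)] by (elim exE conjE) (rule that)
        have "J \<subseteq> {..<Suc n}" using J(1) by (auto simp: less_SucI)
        moreover have "\<forall>a\<in>J. \<forall>b\<in>J. a < b \<longrightarrow> a \<in> N' b"
          using J(1,2) N'j by (auto simp: subset_iff)
        moreover have "\<forall>c\<in>C'. \<forall>v\<in>V - (R - S). (c, v) \<in> E \<longrightarrow> f' v \<in> J \<and> v \<in> B (f' v)"
        proof (intro ballI impI)
          fix c v assume c: "c \<in> C'" and v: "v \<in> V - (R - S)" and cv: "(c, v) \<in> E"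
          \<comment> \<open>A component of \<open>R\<close> other than \<open>C\<close> has no arc
            into \<open>S\<close>, so its old clique model remains valid.\<close>
          have "v \<notin> S"
          proof
            assume "v \<in> S"
            then have "v \<in> R - C'" using S(1) CR 2(2) by blast
            then show False using 2(1) c cv by (auto simp: component_of_def touching_def)
          qed
          then have v': "v \<in> V - R" using v by blast
          show "f' v \<in> J \<and> v \<in> B (f' v)" using nbJ[rule_format, OF c v' cv] by (simp add: f'2[OF v'])
        qed
        ultimately show ?thesis using J(3,4)
          by (intro exI[of _ J] exI[of _ B] conjI)
      qed
    qed
  qed
  then show thesis using that S CR by blast
qed

text \<open>Each step covers a nonempty \<open>S\<close>, so the uncovered set shrinks to nothing.
  At the start nothing is covered and every component carries the empty clique model.\<close>

lemma partition_exists: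
  assumes E: "sym E" and fin: "finite V" and hit: "hitting_bound E V m"
    and small: "clique_minor_bound E V t"
  shows "\<exists>n f N. partial_partition E V m t n {} f N"
proof -
  have "\<exists>n f N. partial_partition E V m t n {} f N" if "partial_partition E V m t n R f N" for n R f N
    using that
  proof (induct "card R" arbitrary: n R f N rule: less_induct)
    case less
    show ?case
    proof (cases "R = {}")
      case False
      obtain S f' N' where S: "S \<subseteq> R" "S \<noteq> {}" "partial_partition E V m t (Suc n) (R - S) f' N'"
        by (rule partial_partition_step[OF E fin hit small less.prems False])
      have "R \<subseteq> V" using less.prems unfolding partial_partition_def by (elim conjE)
      then have "finite R" using fin by (rule finite_subset)
      then have "card (R - S) < card R" using S(1,2) by (intro psubset_card_mono) auto
      then show ?thesis using less.hyps S(3) by blast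
    qed (use less in blast)
  qed
  moreover have "partial_partition E V m t 0 V f N" for f N
    unfolding partial_partition_def
    by (auto simp: rooted_clique_model_def clique_model_def component_of_def)
  ultimately show ?thesis by blast
qed

section \<open>Hitting sets from tree decompositions\<close>

lemma pair_graph_sym: "pair_graph G \<Longrightarrow> sym (parcs G)"
  using pair_sym_digraph.arcs_symmetric pair_graph.axioms(2) pair_pseudo_graph.axioms(2)
  by (metis symI)

lemma pair_graphI:
  assumes "finite (pverts G)" "sym (parcs G)" "parcs G \<subseteq> pverts G \<times> pverts G" "irrefl (parcs G)"
  shows "pair_graph G"
proof -
  have "finite (parcs G)" by (rule finite_subset[OF assms(3)]) (use assms(1) in simp)
  then show ?thesis
    by unfold_locales (use assms in \<open>auto simp: symmetric_def irrefl_def\<close>)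
qed

lemma pair_graphD:
  assumes "pair_graph G"
  shows "finite (pverts G)" "parcs G \<subseteq> pverts G \<times> pverts G" "irrefl (parcs G)"
proof -
  interpret pair_graph G by fact
  show "finite (pverts G)" by (rule pair_finite_verts)
  show "parcs G \<subseteq> pverts G \<times> pverts G" using in_arcsD1 in_arcsD2 by auto
  show "irrefl (parcs G)" using pair_no_loops by (fastforce simp: irrefl_def)
qed

text \<open>The two closures differ only in the reflexive pairs outside \<open>X\<close>.\<close>

lemma rtrancl_on_Restr_iff:
  assumes "x \<in> X"
  shows "(x, y) \<in> rtrancl_on X (Restr E X) \<longleftrightarrow> (x, y) \<in> (Restr E X)\<^sup>*"
proof
  show "(x, y) \<in> (Restr E X)\<^sup>*" if "(x, y) \<in> rtrancl_on X (Restr E X)"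
    using that by (rule rtrancl_on_rtranclI)
  show "(x, y) \<in> rtrancl_on X (Restr E X)" if "(x, y) \<in> (Restr E X)\<^sup>*"
    using that assms by induct (auto intro: rtrancl_on_into_rtrancl_on)
qed

lemma connected_induce_iff:
  assumes "sym (parcs T)"
  shows "connected (with_proj T \<restriction> X) \<longleftrightarrow> connected_on (parcs T) X"
proof -
  have "mk_symmetric (with_proj T \<restriction> X) = \<lparr> pverts = X, parcs = Restr (parcs T) X \<rparr>"
    using assms by (auto simp: mk_symmetric_def induce_subgraph_def with_proj_def dest: symD)
  then show ?thesis
    by (auto simp: connected_def strongly_connected_def reachable_def connected_on_def
        rtrancl_on_Restr_iff)
qed

lemma connected_iff:
  assumes "pair_graph T"
  shows "connected (with_proj T) \<longleftrightarrow> connected_on (parcs T) (pverts T)"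
proof -
  have "with_proj T \<restriction> pverts T = with_proj T"
    using pair_graphD(2)[OF assms] by (auto simp: induce_subgraph_def with_proj_def)
  then show ?thesis using connected_induce_iff[OF pair_graph_sym[OF assms], of "pverts T"] by simp
qed

text \<open>A path from \<open>p\<close> to \<open>q\<close> inside \<open>W\<close> closes up
  through \<open>v\<close>. Since \<open>p\<close> and \<open>q\<close> differ, it has at least one
  arc, and the cycle at least three.\<close>

lemma cycle_through:
  assumes T: "pair_graph T" and W: "connected_on (parcs T) W" "W \<subseteq> pverts T"
    and v: "v \<notin> W" "p \<in> W" "q \<in> W" "p \<noteq> q" "(v, p) \<in> parcs T" "(v, q) \<in> parcs T"
  shows "\<exists>c. pre_digraph.cycle (with_proj T) c \<and> 3 \<le> length c"
proof -
  interpret T: pair_graph T by fact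
  define U where "U = \<lparr> pverts = W, parcs = Restr (parcs T) W \<rparr>"
  have U: "pverts U = W" "parcs U = Restr (parcs T) W" by (simp_all add: U_def)
  have finW: "finite W" using W(2) T.pair_finite_verts by (rule finite_subset)
  have "pair_graph U"
  proof (rule pair_graphI)
    show "sym (parcs U)" using pair_graph_sym[OF T] by (auto simp: U sym_def)
    show "irrefl (parcs U)" using pair_graphD(3)[OF T] by (auto simp: U irrefl_def)
  qed (use finW in \<open>auto simp: U\<close>)
  then interpret U: pair_graph U .
  have "p \<rightarrow>\<^sup>*\<^bsub>with_proj U\<^esub> q"
    using connected_onD[OF W(1) v(2,3)] rtrancl_on_Restr_iff[OF v(2)] by (simp add: reachable_def U)
  then obtain r where r: "U.apath p r q" using U.reachable_apath by blast
  then have r1: "U.awalk p r q" and r2: "distinct (pawalk_verts p r)" by (auto simp: U.apath_def)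
  have rT: "set r \<subseteq> parcs T" "pcas p r q" using r1 by (auto simp: U.awalk_def U)
  have rW: "set (pawalk_verts p r) \<subseteq> W" using r1 U.awalk_verts_in_verts[of p r] by (auto simp: U U.awalk_def)
  have ne: "r \<noteq> []" using rT(2) v(4) by auto
  define c where "c = (v, p) # r @ [(q, v)]"
  have qv: "(q, v) \<in> parcs T" using v(6) pair_graph_sym[OF T] by (simp add: symD)
  have cas: "pcas x (r @ [(q, v)]) v" if "pcas x r q" for x
    using that by (induct r arbitrary: x) auto
  have verts: "pawalk_verts x (r @ [(q, v)]) = pawalk_verts x r @ [v]" if "pcas x r q" for x
    using that by (induct r arbitrary: x) auto
  have "v \<in> pverts T" using v(5) by (rule T.in_arcsD1)
  then have "T.awalk v c v" using rT v(5) qv cas by (auto simp: T.awalk_def c_def)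
  moreover have "distinct (tl (pawalk_verts v c))"
    using verts[OF rT(2)] r2 rW v(1) by (auto simp: c_def)
  ultimately have "T.cycle c" by (auto simp: T.cycle_def c_def)
  moreover have "3 \<le> length c" using ne by (cases r) (auto simp: c_def)
  ultimately show ?thesis by blast
qed

text \<open>A connected set \<open>W\<close> grows by a neighbour \<open>v\<close>; a second
  neighbour of \<open>v\<close> in \<open>W\<close> would close a cycle.\<close>

lemma undirected_tree_leaf_built:
  assumes "undirected_tree T"
  shows "leaf_built (parcs T) (pverts T)"
proof -
  have T: "pair_graph T" and conn: "connected_on (parcs T) (pverts T)"
    and acyc: "\<not> (\<exists>p. pre_digraph.cycle (with_proj T) p \<and> 3 \<le> length p)"
    using assms connected_iff by (auto simp: undirected_tree_def)
  have E: "sym (parcs T)" using T by (rule pair_graph_sym)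
  have "leaf_built (parcs T) (pverts T)"
    if "leaf_built (parcs T) W" "connected_on (parcs T) W" "W \<subseteq> pverts T" for W
    using that
  proof (induct "card (pverts T - W)" arbitrary: W rule: less_induct)
    case less
    show ?case
    proof (cases "W = pverts T")
      case False
      obtain p v where pv: "p \<in> W" "v \<in> pverts T - W" "(p, v) \<in> parcs T"
        using connected_on_crossing[OF conn less.prems(3) connected_on_not_empty[OF less.prems(2)] False]
        by (auto simp: touching_def)
      have vp: "(v, p) \<in> parcs T" using E pv(3) by (rule symD)
      have "q = p" if "q \<in> W" "(v, q) \<in> parcs T" for q
        using cycle_through[OF T less.prems(2,3), of v p q] pv(1,2) that vp acyc by blast
      then have "leaf_built (parcs T) (insert v W)"
        using less.prems(1) pv by (intro leaf_built.leaf[of _ W v p]) auto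
      moreover have "connected_on (parcs T) (insert v W)"
        using connected_on_Un[OF E connected_on_singleton less.prems(2), of v] pv(1) vp
        by (auto simp: touching_def)
      moreover have "card (pverts T - insert v W) < card (pverts T - W)"
        using pv(2) pair_graphD(1)[OF T] by (intro psubset_card_mono) auto
      moreover have "insert v W \<subseteq> pverts T" using less.prems(3) pv(2) by simp
      ultimately show ?thesis by (intro less.hyps[of "insert v W"])
    qed (use less in simp)
  qed
  moreover obtain r where "r \<in> pverts T" using connected_on_not_empty[OF conn] by blast
  ultimately show ?thesis using leaf_built.root connected_on_singleton by (metis empty_subsetI insert_subset)
qed

text \<open>The ends of an edge share a bag, so their node sets overlap. Following a walk in
  \<open>X\<close> chains these connected node sets together.\<close>

lemma tree_decomposition_connected_nodes:
  assumes "tree_decomposition G T B" "connected_on (parcs G) X" "X \<subseteq> pverts G"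
  shows "connected_on (parcs T) {x \<in> pverts T. B x \<inter> X \<noteq> {}}"
proof -
  let ?N = "\<lambda>v. {x \<in> pverts T. v \<in> B x}"
  let ?X = "{x \<in> pverts T. B x \<inter> X \<noteq> {}}"
  have T: "pair_graph T" using assms(1) by (simp add: tree_decomposition_def undirected_tree_def)
  have E: "sym (parcs T)" using T by (rule pair_graph_sym)
  have N: "connected_on (parcs T) (?N v)" if "v \<in> X" for v
    using assms(1,3) that connected_induce_iff[OF E] by (auto simp: tree_decomposition_def)
  have sub: "?N v \<subseteq> ?X" if "v \<in> X" for v using that by blast
  have N': "(x, y) \<in> (Restr (parcs T) ?X)\<^sup>*" if "v \<in> X" "x \<in> ?N v" "y \<in> ?N v" for v x y
    using rtrancl_Restr_mono[OF connected_onD[OF N[OF that(1)] that(2,3)] sub[OF that(1)]] .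
  have edge: "\<exists>x. x \<in> ?N v \<and> x \<in> ?N w" if "(v, w) \<in> parcs G" for v w
    using assms(1) that by (auto simp: tree_decomposition_def)
  have reach: "\<forall>x\<in>?N v. \<forall>y\<in>?N w. (x, y) \<in> (Restr (parcs T) ?X)\<^sup>*"
    if "(v, w) \<in> (Restr (parcs G) X)\<^sup>*" "v \<in> X" for v w
    using that
  proof induct
    case base
    then show ?case using N' by blast
  next
    case (step w w')
    have ww: "(w, w') \<in> parcs G" "w' \<in> X" using step(2) by auto
    obtain z where z: "z \<in> ?N w" "z \<in> ?N w'" using edge[OF ww(1)] by blast
    show ?case
    proof (intro ballI)
      fix x y assume x: "x \<in> ?N v" and y: "y \<in> ?N w'"
      have "(x, z) \<in> (Restr (parcs T) ?X)\<^sup>*" using step(3)[OF step.prems] x z(1) by blast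
      moreover have "(z, y) \<in> (Restr (parcs T) ?X)\<^sup>*" using N'[OF ww(2) z(2) y] .
      ultimately show "(x, y) \<in> (Restr (parcs T) ?X)\<^sup>*" by (rule rtrancl_trans)
    qed
  qed
  obtain v where v: "v \<in> X" using connected_on_not_empty[OF assms(2)] by blast
  obtain a where a: "a \<in> ?N v" using connected_on_not_empty[OF N[OF v]] by blast
  show ?thesis
  proof (rule connected_on_rootI[OF E])
    show "a \<in> ?X" using a sub[OF v] by blast
    fix x assume "x \<in> ?X"
    then obtain w where w: "w \<in> X" "x \<in> ?N w" by blast
    then show "(a, x) \<in> (Restr (parcs T) ?X)\<^sup>*"
      using reach[OF connected_onD[OF assms(2) v w(1)] v] a by blast
  qed
qed

text \<open>Sets with a common vertex \<open>v\<close> both meet every bag containing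
  \<open>v\<close>, so their node sets intersect. By the Helly property one bag of an optimal
  decomposition meets all of them.\<close>

lemma hitting_bound_treewidth:
  assumes "pair_graph G"
  shows "hitting_bound (parcs G) (pverts G) (nat (treewidth G + 1))"
  unfolding hitting_bound_def
proof (intro allI impI)
  fix F assume F: "(\<forall>X\<in>F. X \<subseteq> pverts G \<and> connected_on (parcs G) X) \<and> (\<forall>X\<in>F. \<forall>Y\<in>F. X \<inter> Y \<noteq> {})"
  obtain T :: "nat pair_pre_digraph" and B
    where TB: "tree_decomposition G T B" and w: "width T B = treewidth G"
    using treewidth_attained(1)[OF assms] by blast
  have tree: "undirected_tree T" and T: "pair_graph T" and BG: "\<forall>x\<in>pverts T. B x \<subseteq> pverts G"
    using TB by (auto simp: tree_decomposition_def undirected_tree_def)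
  let ?N = "\<lambda>X. {x \<in> pverts T. B x \<inter> X \<noteq> {}}"
  have "\<exists>x\<in>pverts T. \<forall>Z\<in>?N ` F. x \<in> Z"
  proof (rule leaf_built_Helly[OF undirected_tree_leaf_built[OF tree] pair_graph_sym[OF T]])
    fix Z assume "Z \<in> ?N ` F"
    then show "Z \<subseteq> pverts T \<and> connected_on (parcs T) Z"
      using F tree_decomposition_connected_nodes[OF TB] by auto
  next
    fix Y Z assume "Y \<in> ?N ` F" "Z \<in> ?N ` F"
    then obtain X X' where X: "X \<in> F" "X' \<in> F" "Y = ?N X" "Z = ?N X'" by blast
    then obtain v where v: "v \<in> X" "v \<in> X'" using F by blast
    then have "v \<in> pverts G" using F X(1) by blast
    then have "connected_on (parcs T) {x \<in> pverts T. v \<in> B x}"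
      using TB connected_induce_iff[OF pair_graph_sym[OF T]] by (auto simp: tree_decomposition_def)
    then obtain x where "x \<in> pverts T" "v \<in> B x" using connected_on_not_empty by blast
    then show "Y \<inter> Z \<noteq> {}" using X(3,4) v by blast
  qed
  then obtain x where x: "x \<in> pverts T" "\<forall>X\<in>F. B x \<inter> X \<noteq> {}" by auto
  have "card (B x) \<le> Max ((\<lambda>x. card (B x)) ` pverts T)"
    using x(1) pair_graphD(1)[OF T] by (intro Max_ge) auto
  then have "card (B x) \<le> nat (treewidth G + 1)" using w by (simp add: width_def)
  moreover have "finite (B x)" using BG x(1) pair_graphD(1)[OF assms] finite_subset by metis
  ultimately show "\<exists>B. finite B \<and> card B \<le> nat (treewidth G + 1) \<and> (\<forall>X\<in>F. X \<inter> B \<noteq> {})"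
    using x(2) by (intro exI[of _ "B x"]) (simp add: Int_commute)
qed

section \<open>Treewidth of graphs built by attaching vertices to cliques\<close>

text \<open>The guards \<open>0 < i\<close> and \<open>0 < j\<close> make \<open>0\<close> the
  root.\<close>

definition parent_tree :: "nat \<Rightarrow> (nat \<Rightarrow> nat) \<Rightarrow> nat pair_pre_digraph" where
  "parent_tree n par = \<lparr> pverts = {..n},
     parcs = {(i, j). i \<le> n \<and> j \<le> n \<and> (0 < i \<and> j = par i \<or> 0 < j \<and> i = par j)} \<rparr>"

text \<open>Parents decrease and stay in \<open>X\<close>, so climbing from any vertex of
  \<open>X\<close> ends at \<open>a\<close>.\<close>

lemma parent_tree_connected_on:
  assumes "a \<in> X" "X \<subseteq> {..n}" "\<And>x. x \<in> X \<Longrightarrow> x \<noteq> a \<Longrightarrow> 0 < x \<and> par x < x \<and> par x \<in> X"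
  shows "connected_on (parcs (parent_tree n par)) X"
proof (rule connected_on_rootI)
  show "sym (parcs (parent_tree n par))" by (auto simp: parent_tree_def sym_def)
  show "a \<in> X" by fact
  fix x assume "x \<in> X"
  then show "(a, x) \<in> (Restr (parcs (parent_tree n par)) X)\<^sup>*"
  proof (induct x rule: less_induct)
    case (less x)
    show ?case
    proof (cases "x = a")
      case False
      have px: "0 < x" "par x < x" "par x \<in> X" using assms(3)[OF less.prems False] by auto
      then have "(par x, x) \<in> Restr (parcs (parent_tree n par)) X"
        using less.prems assms(2) by (auto simp: parent_tree_def)
      with less.hyps[OF px(2,3)] show ?thesis by (rule rtrancl_into_rtrancl)
    qed simp
  qed
qed

text \<open>Indices modulo the length turn a closed walk into a cyclic sequence of arcs; the last
  arc meets the first one at \<open>u\<close>.\<close>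

lemma pcas_nth:
  assumes "pcas u p u" "i < length p"
  shows "snd (p ! i) = fst (p ! (Suc i mod length p))"
proof -
  have step: "Suc i < length p \<Longrightarrow> snd (p ! i) = fst (p ! Suc i)" if "pcas u p v" for u v i
    using that
  proof (induct p arbitrary: u i)
    case (Cons e p)
    then show ?case by (cases p; cases i) auto
  qed simp
  have last: "p \<noteq> [] \<Longrightarrow> snd (last p) = v \<and> fst (hd p) = u" if "pcas u p v" for u v
    using that
  proof (induct p arbitrary: u)
    case (Cons e p)
    then show ?case by (cases p) auto
  qed simp
  show ?thesis
  proof (cases "Suc i = length p")
    case True
    then have "p \<noteq> []" by auto
    moreover have "i = length p - 1" using True by simp
    ultimately show ?thesis using last[OF assms(1)] True by (simp add: last_conv_nth hd_conv_nth)
  next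
    case False
    then show ?thesis using step[OF assms(1), of i] assms(2) by simp
  qed
qed

text \<open>Both neighbours of the largest vertex of a cycle would be its parent.\<close>

lemma undirected_tree_parent_tree:
  assumes par: "\<And>i. 0 < i \<Longrightarrow> par i < i"
  shows "undirected_tree (parent_tree n par)"
proof -
  let ?T = "parent_tree n par"
  have T: "pair_graph ?T"
  proof (rule pair_graphI)
    have "(a, a) \<notin> parcs ?T" for a using par[of a] by (auto simp: parent_tree_def)
    then show "irrefl (parcs ?T)" by (rule irreflI)
  qed (auto simp: parent_tree_def sym_def)
  interpret pair_graph ?T by fact
  have "connected_on (parcs ?T) {..n}"
  proof (rule parent_tree_connected_on[of 0])
    fix x assume "x \<in> {..n}" "x \<noteq> 0"
    then show "0 < x \<and> par x < x \<and> par x \<in> {..n}" using par[of x] by simp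
  qed simp_all
  then have conn: "connected (with_proj ?T)" using connected_iff[OF T] by (simp add: parent_tree_def)
  have "\<not> 3 \<le> length p" if cyc: "cycle p" for p
  proof
    assume len: "3 \<le> length p"
    obtain u where u: "set p \<subseteq> parcs ?T" "pcas u p u" "distinct (tl (pawalk_verts u p))"
      using cyc by (auto simp: cycle_def awalk_def)
    let ?k = "length p"
    have "pawalk_verts u p = u # map snd p" if "pcas u p v" for u v
      using that by (induct p arbitrary: u) auto
    from this[OF u(2)] have dist: "distinct (map snd p)" using u(3) by simp
    have "finite (snd ` set p)" "snd ` set p \<noteq> {}" using len by auto
    then have "Max (snd ` set p) \<in> snd ` set p" by (rule Max_in)
    then obtain i where i: "i < ?k" "snd (p ! i) = Max (snd ` set p)"
      by (auto simp: in_set_conv_nth)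
    have max: "snd (p ! j) \<le> snd (p ! i)" if "j < ?k" for j
      using that i(2) by simp
    \<comment> \<open>The smaller end of an arc is the parent of the larger one.\<close>
    have up: "b = par a" if "(a, b) \<in> parcs ?T \<or> (b, a) \<in> parcs ?T" "b \<le> a" for a b
      using that par[of a] par[of b] by (auto simp: parent_tree_def)
    \<comment> \<open>\<open>j\<close> and \<open>h\<close> are the cyclic successor and predecessor
      of \<open>i\<close>. They differ because the cycle has length at least three.\<close>
    define j where "j = Suc i mod ?k"
    define h where "h = (if i = 0 then ?k - 1 else i - 1)"
    have jk: "j < ?k" unfolding j_def by (rule mod_less_divisor) (use len in linarith)
    have hk: "h < ?k" and hi: "Suc h mod ?k = i" using i(1) len by (auto simp: h_def)
    have jh: "j \<noteq> h" using i(1) len by (cases "Suc i = ?k") (auto simp: j_def h_def)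
    have pj: "fst (p ! j) = snd (p ! i)" using pcas_nth[OF u(2) i(1)] by (simp add: j_def)
    have ph: "fst (p ! i) = snd (p ! h)" using pcas_nth[OF u(2) hk] by (simp add: hi)
    have arc: "(fst (p ! l), snd (p ! l)) \<in> parcs ?T" if "l < ?k" for l
      using u(1) nth_mem[OF that] by auto
    have "snd (p ! j) = par (snd (p ! i))" using up[OF _ max[OF jk]] arc[OF jk] pj by simp
    moreover have "snd (p ! h) = par (snd (p ! i))" using up[OF _ max[OF hk]] arc[OF i(1)] ph by simp
    ultimately have "j = h" using dist jk hk by (simp add: distinct_conv_nth) metis
    with jh show False by simp
  qed
  then show ?thesis using T conn by (auto simp: undirected_tree_def)
qed

text \<open>When each \<open>N j\<close> is a clique, this is a chordal graph, and the decreasing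
  order of its vertices is a perfect elimination order.\<close>

definition back_graph :: "nat \<Rightarrow> (nat \<Rightarrow> nat set) \<Rightarrow> nat pair_pre_digraph" where
  "back_graph n N = \<lparr> pverts = {..<n}, parcs = {(i, j). i < n \<and> j < n \<and> (i \<in> N j \<or> j \<in> N i)} \<rparr>"

lemma pair_graph_back_graph:
  assumes "\<And>j. j < n \<Longrightarrow> N j \<subseteq> {..<j}"
  shows "pair_graph (back_graph n N)"
proof (rule pair_graphI)
  have "(a, a) \<notin> parcs (back_graph n N)" for a using assms[of a] by (auto simp: back_graph_def)
  then show "irrefl (parcs (back_graph n N))" by (rule irreflI)
qed (auto simp: back_graph_def sym_def)

text \<open>Node \<open>Suc j\<close> carries the bag consisting of \<open>j\<close> and \<open>N j\<close>, and its parent is the node of the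
  largest element of \<open>N j\<close>. Node \<open>0\<close> has an empty bag; it collects the \<open>j\<close> with \<open>N j = {}\<close> and
  keeps the tree nonempty when \<open>n = 0\<close>.\<close>

lemma treewidth_back_graph:
  assumes N: "\<And>j. j < n \<Longrightarrow> N j \<subseteq> {..<j}" and k: "\<And>j. j < n \<Longrightarrow> card (N j) \<le> k"
    and clique: "\<And>j a b. j < n \<Longrightarrow> a \<in> N j \<Longrightarrow> b \<in> N j \<Longrightarrow> a < b \<Longrightarrow> a \<in> N b"
  shows "treewidth (back_graph n N) \<le> int k"
proof -
  let ?H = "back_graph n N"
  \<comment> \<open>The guard \<open>x \<le> n\<close> makes parents smaller beyond the range of
    \<open>N\<close> as well, where \<open>N\<close> is unconstrained.\<close>
  define par where "par x = (if x \<le> n \<and> N (x - 1) \<noteq> {} then Suc (Max (N (x - 1))) else 0)" for x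
  define B where "B x = (if x = 0 then {} else insert (x - 1) (N (x - 1)))" for x
  let ?T = "parent_tree n par"
  have fin: "finite (N j)" if "j < n" for j using N[OF that] finite_subset by blast
  have par_Suc: "par (Suc j) = Suc (Max (N j)) \<and> Max (N j) \<in> N j \<and> Max (N j) < j"
    if "j < n" "N j \<noteq> {}" for j
    using Max_in[OF fin[OF that(1)] that(2)] N[OF that(1)] that by (auto simp: par_def)
  have par_less: "par x < x" if "0 < x" for x
  proof (cases "x \<le> n \<and> N (x - 1) \<noteq> {}")
    case True
    moreover have "x - 1 < n" using True that by linarith
    ultimately show ?thesis using par_Suc[of "x - 1"] that by auto
  next
    case False
    show ?thesis using that unfolding par_def if_not_P[OF False] .
  qed
  have "tree_decomposition ?H ?T B"
    unfolding tree_decomposition_def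
  proof (intro conjI)
    show tree: "undirected_tree ?T" using par_less by (rule undirected_tree_parent_tree)
    show "\<forall>x\<in>pverts ?T. B x \<subseteq> pverts ?H"
    proof
      fix x assume "x \<in> pverts ?T"
      then have "x \<le> n" by (simp add: parent_tree_def)
      then show "B x \<subseteq> pverts ?H"
        using N[of "x - 1"] by (cases x) (auto simp: B_def back_graph_def)
    qed
    show "\<forall>(v, w)\<in>parcs ?H. \<exists>x\<in>pverts ?T. v \<in> B x \<and> w \<in> B x"
    proof (safe)
      fix v w assume "(v, w) \<in> parcs ?H"
      then have vw: "v < n" "w < n" "v \<in> N w \<or> w \<in> N v" by (auto simp: back_graph_def)
      then show "\<exists>x\<in>pverts ?T. v \<in> B x \<and> w \<in> B x"
        by (intro bexI[of _ "if v \<in> N w then Suc w else Suc v"]) (auto simp: B_def parent_tree_def)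
    qed
    show "\<forall>v\<in>pverts ?H. connected (with_proj ?T \<restriction> {x \<in> pverts ?T. v \<in> B x})"
    proof
      fix v assume "v \<in> pverts ?H"
      then have v: "v < n" by (simp add: back_graph_def)
      have "connected_on (parcs ?T) {x \<in> pverts ?T. v \<in> B x}"
      proof (rule parent_tree_connected_on[of "Suc v"])
        show "Suc v \<in> {x \<in> pverts ?T. v \<in> B x}" using v by (simp add: B_def parent_tree_def)
        show "{x \<in> pverts ?T. v \<in> B x} \<subseteq> {..n}" by (auto simp: parent_tree_def)
        fix x assume x: "x \<in> {x \<in> pverts ?T. v \<in> B x}" "x \<noteq> Suc v"
        then obtain j where j: "x = Suc j" by (cases x) (auto simp: B_def)
        then have jn: "j < n" "v \<in> N j" using x by (auto simp: B_def parent_tree_def)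
        then have p: "par x = Suc (Max (N j))" "Max (N j) \<in> N j" "Max (N j) < j"
          using par_Suc[of j] j by auto
        have "v \<le> Max (N j)" using fin[OF jn(1)] jn(2) by simp
        \<comment> \<open>The clique condition keeps \<open>v\<close> in the bag of the parent
          node.\<close>
        then have "v = Max (N j) \<or> v \<in> N (Max (N j))" using clique[OF jn p(2)] by linarith
        then show "0 < x \<and> par x < x \<and> par x \<in> {x \<in> pverts ?T. v \<in> B x}"
          using p j jn by (auto simp: B_def parent_tree_def)
      qed
      then show "connected (with_proj ?T \<restriction> {x \<in> pverts ?T. v \<in> B x})"
        by (subst connected_induce_iff) (auto simp: parent_tree_def sym_def)
    qed
  qed
  moreover have "pair_graph ?H" using N by (rule pair_graph_back_graph)
  ultimately have "treewidth ?H \<le> width ?T B" by (intro treewidth_attained(2))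
  also have "\<dots> \<le> int k"
  proof -
    have "card (B x) \<le> Suc k" if "x \<le> n" for x
    proof (cases x)
      case (Suc j)
      then show ?thesis using k[of j] that fin[of j] by (simp add: B_def card_insert_if)
    qed (simp add: B_def)
    then have "Max ((\<lambda>x. card (B x)) ` {..n}) \<le> Suc k" by (subst Max_le_iff) auto
    moreover have "width ?T B = int (Max ((\<lambda>x. card (B x)) ` {..n})) - 1"
      by (simp add: width_def parent_tree_def)
    ultimately show ?thesis by linarith
  qed
  finally show ?thesis .
qed

section \<open>Clique minors from clique models\<close>

text \<open>Arcs collapsed by \<open>g\<close> become stationary steps of the image walk, the others
  become arcs of \<open>E'\<close>. It is applied to the map of an edge contraction.\<close>

lemma connected_on_image:
  assumes "connected_on E X"
    and g: "\<And>x y. x \<in> X \<Longrightarrow> y \<in> X \<Longrightarrow> (x, y) \<in> E \<Longrightarrow> g x \<noteq> g y \<Longrightarrow> (g x, g y) \<in> E'"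
  shows "connected_on E' (g ` X)"
proof -
  have "(g x, g y) \<in> (Restr E' (g ` X))\<^sup>*" if "(x, y) \<in> (Restr E X)\<^sup>*" for x y
    using that
  proof induct
    case (step y z)
    show ?case
    proof (cases "g y = g z")
      case False
      then have "(g y, g z) \<in> Restr E' (g ` X)" using step(2) g by auto
      with step(3) show ?thesis by (rule rtrancl_into_rtrancl)
    qed (use step in simp)
  qed simp
  then show ?thesis using assms(1) by (auto simp: connected_on_def)
qed

lemma contracts_to_trans:
  assumes "contracts_to H C" "contracts_to G H"
  shows "contracts_to G C"
  using assms by induct (auto intro: contracts_to.step)

lemma contract_edge_simps:
  "pverts (contract_edge G u v) = (\<lambda>x. if x = v then u else x) ` pverts G"
  "parcs (contract_edge G u v) = {((if x = v then u else x), (if y = v then u else y)) | x y.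
     (x, y) \<in> parcs G \<and> (if x = v then u else x) \<noteq> (if y = v then u else y)}"
  by (simp_all add: contract_edge_def Let_def)

lemma pair_graph_contract_edge:
  assumes "pair_graph G"
  shows "pair_graph (contract_edge G u v)"
proof -
  define g where "g x = (if x = v then u else x)" for x
  let ?C = "contract_edge G u v"
  have C: "pverts ?C = g ` pverts G" "parcs ?C = {(g x, g y) | x y. (x, y) \<in> parcs G \<and> g x \<noteq> g y}"
    unfolding contract_edge_simps g_def by simp_all
  show ?thesis
  proof (rule pair_graphI)
    show "finite (pverts ?C)" using pair_graphD(1)[OF assms] by (simp add: C)
    show "sym (parcs ?C)"
    proof (rule symI)
      fix a b assume "(a, b) \<in> parcs ?C"
      then obtain x y where xy: "a = g x" "b = g y" "(x, y) \<in> parcs G" "a \<noteq> b" by (auto simp: C)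
      have "(y, x) \<in> parcs G" using pair_graph_sym[OF assms] xy(3) by (rule symD)
      then show "(b, a) \<in> parcs ?C" using xy(1,2,4)
        unfolding C by (intro CollectI exI[of _ y] exI[of _ x]) auto
    qed
    show "parcs ?C \<subseteq> pverts ?C \<times> pverts ?C" using pair_graphD(2)[OF assms] by (auto simp: C)
    show "irrefl (parcs ?C)" by (rule irreflI) (simp add: C)
  qed
qed

text \<open>\<open>\<phi>\<close> sends a vertex to the index of its branch set. As long as
  \<open>\<phi>\<close> is not injective, an edge inside a fibre is contracted, which keeps fibres
  connected and touching. With singleton fibres, touching means that the graph is complete.\<close>

lemma contracts_to_complete:
  assumes "pair_graph G" "\<phi> ` pverts G = I"
    and "\<And>i. i \<in> I \<Longrightarrow> connected_on (parcs G) {x \<in> pverts G. \<phi> x = i}"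
    and "\<And>i j. i \<in> I \<Longrightarrow> j \<in> I \<Longrightarrow> i \<noteq> j \<Longrightarrow> \<exists>x y. (x, y) \<in> parcs G \<and> \<phi> x = i \<and> \<phi> y = j"
  shows "\<exists>C. contracts_to G C \<and> pair_graph C \<and> bij_betw \<phi> (pverts C) I \<and>
    parcs C = {(x, y). x \<in> pverts C \<and> y \<in> pverts C \<and> x \<noteq> y}"
  using assms
proof (induct "card (pverts G)" arbitrary: G rule: less_induct)
  case less
  note G = less.prems(1) and im = less.prems(2) and fib = less.prems(3) and touch = less.prems(4)
  show ?case
  proof (cases "inj_on \<phi> (pverts G)")
    case True
    have "(x, y) \<in> parcs G" if xy: "x \<in> pverts G" "y \<in> pverts G" "x \<noteq> y" for x y
    proof -
      have "\<phi> x \<noteq> \<phi> y" using True xy by (simp add: inj_on_eq_iff)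
      then obtain x' y' where e: "(x', y') \<in> parcs G" "\<phi> x' = \<phi> x" "\<phi> y' = \<phi> y"
        using touch[of "\<phi> x" "\<phi> y"] im xy by blast
      then have "x' \<in> pverts G" "y' \<in> pverts G" using pair_graphD(2)[OF G] by auto
      then have "x' = x" "y' = y" using True e xy by (auto simp: inj_on_eq_iff)
      then show ?thesis using e by simp
    qed
    then have "parcs G = {(x, y). x \<in> pverts G \<and> y \<in> pverts G \<and> x \<noteq> y}"
      using pair_graphD(2,3)[OF G] by (auto simp: irrefl_def)
    then show ?thesis
      using True im G contracts_to.refl[of G] by (intro exI[of _ G]) (simp add: bij_betw_def)
  next
    case False
    then obtain a b where ab: "a \<in> pverts G" "b \<in> pverts G" "\<phi> a = \<phi> b" "a \<noteq> b"
      by (auto simp: inj_on_def)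
    let ?X = "{x \<in> pverts G. \<phi> x = \<phi> a}"
    have "connected_on (parcs G) ?X" using im ab(1) by (intro fib) auto
    \<comment> \<open>\<open>a\<close> and \<open>b\<close> need not be adjacent, but a connected
      fibre with further vertices contains a neighbour of \<open>a\<close>.\<close>
    then have "touching (parcs G) {a} (?X - {a})"
      by (rule connected_on_crossing) (use ab in auto)
    then obtain v where v: "(a, v) \<in> parcs G" "v \<in> pverts G" "\<phi> v = \<phi> a" "v \<noteq> a"
      by (auto simp: touching_def)
    define g where "g x = (if x = v then a else x)" for x
    define C where "C = contract_edge G a v"
    have C: "pverts C = g ` pverts G" "parcs C = {(g x, g y) | x y. (x, y) \<in> parcs G \<and> g x \<noteq> g y}"
      unfolding C_def contract_edge_simps g_def by simp_all
    have \<phi>g: "\<phi> (g x) = \<phi> x" for x using v by (simp add: g_def)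
    have "\<exists>D. contracts_to C D \<and> pair_graph D \<and> bij_betw \<phi> (pverts D) I \<and>
      parcs D = {(x, y). x \<in> pverts D \<and> y \<in> pverts D \<and> x \<noteq> y}"
    proof (rule less.hyps)
      have "pverts C = pverts G - {v}" using ab(1) v by (auto simp: C(1) g_def)
      then show "card (pverts C) < card (pverts G)"
        using card_Diff1_less[OF pair_graphD(1)[OF G] v(2)] by metis
      show "pair_graph C" unfolding C_def using G by (rule pair_graph_contract_edge)
      show "\<phi> ` pverts C = I" using im by (simp add: C(1) image_image \<phi>g)
      show "connected_on (parcs C) {x \<in> pverts C. \<phi> x = i}" if "i \<in> I" for i
      proof -
        have "{x \<in> pverts C. \<phi> x = i} = g ` {x \<in> pverts G. \<phi> x = i}" by (auto simp: C(1) \<phi>g)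
        moreover have "connected_on (parcs C) (g ` {x \<in> pverts G. \<phi> x = i})"
          by (rule connected_on_image[OF fib[OF that]]) (auto simp: C(2))
        ultimately show ?thesis by simp
      qed
      show "\<exists>x y. (x, y) \<in> parcs C \<and> \<phi> x = i \<and> \<phi> y = j" if ij: "i \<in> I" "j \<in> I" "i \<noteq> j" for i j
      proof -
        obtain x y where xy: "(x, y) \<in> parcs G" "\<phi> x = i" "\<phi> y = j" using touch[OF ij] by blast
        then have "g x \<noteq> g y" using ij(3) \<phi>g by metis
        then have "(g x, g y) \<in> parcs C" using xy(1) C(2) by blast
        then show ?thesis using xy \<phi>g by metis
      qed
    qed
    then obtain D where D: "contracts_to C D" "pair_graph D" "bij_betw \<phi> (pverts D) I"
      "parcs D = {(x, y). x \<in> pverts D \<and> y \<in> pverts D \<and> x \<noteq> y}" by (elim exE conjE)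
    have "contracts_to G C" unfolding C_def using contracts_to.refl v(1) by (rule contracts_to.step)
    then have "contracts_to G D" using D(1) contracts_to_trans by metis
    then show ?thesis using D(2-4) by (intro exI[of _ D] conjI)
  qed
qed

lemma digraph_iso_with_projI:
  assumes "pair_graph G" "inj_on h (pverts G)" "pverts H = h ` pverts G" "parcs H = map_prod h h ` parcs G"
  shows "digraph_iso (with_proj G) (with_proj H)"
proof -
  interpret pair_graph G by fact
  let ?h = "\<lparr> iso_verts = h, iso_arcs = map_prod h h, iso_head = snd, iso_tail = fst \<rparr>"
  have "inj_on (map_prod h h) (parcs G)"
    using map_prod_inj_on[OF assms(2,2)] pair_graphD(2)[OF assms(1)] by (rule inj_on_subset)
  then have "digraph_isomorphism ?h"
    using assms(2) wf_digraph_axioms by (auto simp: digraph_isomorphism_def)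
  moreover have "with_proj H = app_iso ?h (with_proj G)"
    using assms(3,4) by (simp add: app_iso_def with_proj_def)
  ultimately show ?thesis unfolding digraph_iso_def by blast
qed

lemma subgraph_with_projI:
  assumes "pair_graph H" "pair_graph G" "pverts H \<subseteq> pverts G" "parcs H \<subseteq> parcs G"
  shows "subgraph (with_proj H) (with_proj G)"
proof -
  interpret H: pair_graph H by fact
  interpret G: pair_graph G by fact
  show ?thesis
    using assms(3,4) H.wf_digraph_axioms G.wf_digraph_axioms
    by (auto simp: subgraph_def compatible_def)
qed

text \<open>Restrict to \<open>t\<close> branch sets, take the subgraph induced by their union, and
  contract each of them to a vertex.\<close>

lemma is_minor_complete_graphI:
  assumes G: "pair_graph G" and I: "finite I" "t \<le> card I"
    and mod: "clique_model (parcs G) I A" and AV: "\<And>i. i \<in> I \<Longrightarrow> A i \<subseteq> pverts G"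
  shows "is_minor (complete_graph t) G"
proof -
  obtain J where J: "J \<subseteq> I" "card J = t" "finite J"
    using obtain_subset_with_card_n[OF I(2)] by metis
  have conn: "connected_on (parcs G) (A i)" if "i \<in> J" for i
    using mod J(1) that by (auto simp: clique_model_def)
  have disj: "A i \<inter> A j = {}" and touch: "touching (parcs G) (A i) (A j)"
    if "i \<in> J" "j \<in> J" "i \<noteq> j" for i j
    using mod J(1) that by (auto simp: clique_model_def subset_iff)
  define W where "W = (\<Union>i\<in>J. A i)"
  define S where "S = \<lparr> pverts = W, parcs = Restr (parcs G) W \<rparr>"
  have S: "pverts S = W" "parcs S = Restr (parcs G) W" by (simp_all add: S_def)
  have WG: "W \<subseteq> pverts G" using AV J(1) by (auto simp: W_def)
  have pS: "pair_graph S"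
  proof (rule pair_graphI)
    show "finite (pverts S)" unfolding S using WG pair_graphD(1)[OF G] by (rule finite_subset)
    show "sym (parcs S)" using pair_graph_sym[OF G] by (auto simp: S sym_def)
    show "irrefl (parcs S)" using pair_graphD(3)[OF G] by (auto simp: S irrefl_def)
  qed (auto simp: S)
  define \<phi> where "\<phi> x = (THE i. i \<in> J \<and> x \<in> A i)" for x
  have \<phi>: "\<phi> x = i" if "i \<in> J" "x \<in> A i" for x i
    unfolding \<phi>_def
  proof (rule the_equality)
    fix j assume "j \<in> J \<and> x \<in> A j"
    then show "j = i" using disj[of i j] that by blast
  qed (use that in simp)
  have fib: "{x \<in> pverts S. \<phi> x = i} = A i" if "i \<in> J" for i
    using \<phi> that by (auto simp: S W_def)
  have "\<exists>C. contracts_to S C \<and> pair_graph C \<and> bij_betw \<phi> (pverts C) J \<and>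
    parcs C = {(x, y). x \<in> pverts C \<and> y \<in> pverts C \<and> x \<noteq> y}"
  proof (rule contracts_to_complete[OF pS])
    show "\<phi> ` pverts S = J"
    proof
      show "\<phi> ` pverts S \<subseteq> J" using \<phi> by (auto simp: S W_def)
      show "J \<subseteq> \<phi> ` pverts S"
      proof
        fix i assume i: "i \<in> J"
        obtain x where "x \<in> A i" using connected_on_not_empty[OF conn[OF i]] by blast
        then show "i \<in> \<phi> ` pverts S" using \<phi>[OF i] i by (force simp: S W_def)
      qed
    qed
    fix i assume i: "i \<in> J"
    then have "A i \<subseteq> W" by (auto simp: W_def)
    then have "Restr (parcs S) (A i) = Restr (parcs G) (A i)" by (auto simp: S)
    then show "connected_on (parcs S) {x \<in> pverts S. \<phi> x = i}"
      using conn[OF i] unfolding fib[OF i] by (simp add: connected_on_def)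
    fix j assume j: "j \<in> J" "i \<noteq> j"
    obtain x y where xy: "x \<in> A i" "y \<in> A j" "(x, y) \<in> parcs G"
      using touch[OF i j] by (auto simp: touching_def)
    then have "(x, y) \<in> parcs S" using i j by (auto simp: S W_def)
    then show "\<exists>x y. (x, y) \<in> parcs S \<and> \<phi> x = i \<and> \<phi> y = j"
      using \<phi>[OF i xy(1)] \<phi>[OF j(1) xy(2)] by blast
  qed
  then obtain C where C: "contracts_to S C" "pair_graph C" "bij_betw \<phi> (pverts C) J"
    "parcs C = {(x, y). x \<in> pverts C \<and> y \<in> pverts C \<and> x \<noteq> y}" by (elim exE conjE)
  \<comment> \<open>\<open>b\<close> renumbers the chosen indices by the vertices of the complete
    graph.\<close>
  obtain b where b: "bij_betw b J {0..<t}" using ex_bij_betw_finite_nat[OF J(3)] J(2) by blast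
  define h where "h = b \<circ> \<phi>"
  have h: "bij_betw h (pverts C) {..<t}"
    using bij_betw_trans[OF C(3) b] by (simp add: h_def atLeast0LessThan)
  then have inj: "inj_on h (pverts C)" and im: "h ` pverts C = {..<t}" by (auto simp: bij_betw_def)
  have "digraph_iso (with_proj C) (with_proj (complete_graph t))"
  proof (rule digraph_iso_with_projI[OF C(2) inj])
    show "pverts (complete_graph t) = h ` pverts C" using im by (simp add: complete_graph_def)
    show "parcs (complete_graph t) = map_prod h h ` parcs C"
    proof (rule set_eqI, clarify)
      fix i j
      have "(i, j) \<in> parcs (complete_graph t) \<longleftrightarrow> i \<in> h ` pverts C \<and> j \<in> h ` pverts C \<and> i \<noteq> j"
        unfolding im by (auto simp: complete_graph_def)
      also have "\<dots> \<longleftrightarrow> (i, j) \<in> map_prod h h ` parcs C"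
        unfolding C(4) using inj by (auto simp: inj_on_eq_iff)
      finally show "(i, j) \<in> parcs (complete_graph t) \<longleftrightarrow> (i, j) \<in> map_prod h h ` parcs C" .
    qed
  qed
  moreover have "subgraph (with_proj S) (with_proj G)"
    by (rule subgraph_with_projI[OF pS G]) (use WG in \<open>auto simp: S\<close>)
  ultimately show ?thesis unfolding is_minor_def using pS C(1) by blast
qed

section \<open>Product structure\<close>

lemma pair_graph_complete_graph: "pair_graph (complete_graph n)"
  using complete_digraph_complete_graph pair_graphI_graph by (auto simp: complete_digraph_def)

text \<open>The first coordinate of a vertex is its part, the second its number within the part,
  below \<open>m\<close>. Distinct numbers are adjacent in the complete graph, so only the first
  coordinate restricts which edges are allowed.\<close>

lemma isomorphic_to_subgraph_strong_productI:
  assumes G: "pair_graph G" and H: "pair_graph H"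
    and f: "\<And>v. v \<in> pverts G \<Longrightarrow> f v \<in> pverts H"
    and fib: "\<And>i. i \<in> pverts H \<Longrightarrow> card {v \<in> pverts G. f v = i} \<le> m"
    and edge: "\<And>u v. (u, v) \<in> parcs G \<Longrightarrow> f u = f v \<or> (f u, f v) \<in> parcs H"
  shows "isomorphic_to_subgraph G (H \<boxtimes> complete_graph m)"
proof -
  have "\<forall>i\<in>pverts H. \<exists>g. inj_on g {v \<in> pverts G. f v = i} \<and> g ` {v \<in> pverts G. f v = i} \<subseteq> {..<m}"
    using fib pair_graphD(1)[OF G] by (subst inj_on_iff_card_le) auto
  from bchoice[OF this] obtain g where
    "\<forall>i\<in>pverts H. inj_on (g i) {v \<in> pverts G. f v = i} \<and> g i ` {v \<in> pverts G. f v = i} \<subseteq> {..<m}"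
    by (rule exE)
  then have g: "inj_on (g i) {v \<in> pverts G. f v = i}" "g i ` {v \<in> pverts G. f v = i} \<subseteq> {..<m}"
    if "i \<in> pverts H" for i using that by simp_all
  define h where "h v = (f v, g (f v) v)" for v
  have gm: "g (f v) v < m" if "v \<in> pverts G" for v using g(2)[OF f[OF that]] that by auto
  have inj: "inj_on h (pverts G)"
  proof (rule inj_onI)
    fix u v assume uv: "u \<in> pverts G" "v \<in> pverts G" "h u = h v"
    then have "f u = f v" "g (f v) u = g (f v) v" by (auto simp: h_def)
    then show "u = v" using inj_onD[OF g(1)[OF f[OF uv(2)]]] uv by blast
  qed
  let ?X = "H \<boxtimes> complete_graph m"
  define S where "S = \<lparr> pverts = h ` pverts G, parcs = map_prod h h ` parcs G \<rparr>"
  have GV: "u \<in> pverts G" "v \<in> pverts G" "u \<noteq> v" if "(u, v) \<in> parcs G" for u v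
    using that pair_graphD(2,3)[OF G] by (auto simp: irrefl_def)
  have pS: "pair_graph S"
  proof (rule pair_graphI)
    show "sym (parcs S)" using pair_graph_sym[OF G] by (force simp: S_def sym_def)
    show "irrefl (parcs S)" using GV inj by (fastforce simp: S_def irrefl_def inj_on_eq_iff)
  qed (use GV pair_graphD(1)[OF G] in \<open>auto simp: S_def\<close>)
  have verts: "pverts S \<subseteq> pverts ?X"
    using f gm by (auto simp: S_def h_def strong_product_def complete_graph_def)
  have arcs: "parcs S \<subseteq> parcs ?X"
  proof -
    have "(h u, h v) \<in> parcs ?X" if uv: "(u, v) \<in> parcs G" for u v
    proof -
      note V = GV[OF uv]
      have ne: "h u \<noteq> h v" using inj V by (simp add: inj_on_eq_iff)
      then show ?thesis
        using edge[OF uv] f[OF V(1)] f[OF V(2)] gm[OF V(1)] gm[OF V(2)]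
        by (auto simp: h_def strong_product_def complete_graph_def)
    qed
    then show ?thesis by (auto simp: S_def)
  qed
  have "digraph_iso (with_proj G) (with_proj S)"
    by (rule digraph_iso_with_projI[OF G inj]) (simp_all add: S_def)
  moreover have "subgraph (with_proj S) (with_proj ?X)"
    by (rule subgraph_with_projI[OF pS pair_graph_strong_product[OF H pair_graph_complete_graph] verts arcs])
  ultimately show ?thesis unfolding isomorphic_to_subgraph_def using pS by blast
qed

theorem theorem4:
  fixes G :: "'a pair_pre_digraph" and t :: nat
  assumes "t \<ge> 2"
    and "pair_graph G"
    and "\<not> is_minor (complete_graph t) G"
  shows "\<exists>H :: nat pair_pre_digraph. pair_graph H \<and> treewidth H \<le> int t - 2 \<and>
    isomorphic_to_subgraph G (H \<boxtimes> complete_graph (nat (treewidth G + 1)))"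
proof -
  \<comment> \<open>Treewidth is at least -1, so \<open>nat\<close> changes nothing here.\<close>
  let ?m = "nat (treewidth G + 1)"
  have small: "clique_minor_bound (parcs G) (pverts G) t"
    unfolding clique_minor_bound_def
  proof (intro allI impI)
    fix I :: "nat set" and A
    assume "finite I \<and> clique_model (parcs G) I A \<and> (\<forall>i\<in>I. A i \<subseteq> pverts G)"
    then show "card I < t" using is_minor_complete_graphI[OF assms(2), of I t A] assms(3) by fastforce
  qed
  obtain n f N where part: "partial_partition (parcs G) (pverts G) ?m t n {} f N"
    using partition_exists[OF pair_graph_sym[OF assms(2)] pair_graphD(1)[OF assms(2)]
        hitting_bound_treewidth[OF assms(2)] small] by blast
  have f: "\<forall>v\<in>pverts G - {}. f v < n"
    using part unfolding partial_partition_def by (elim conjE)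
  have "\<forall>j<n. N j \<subseteq> {..<j} \<and> card (N j) + 2 \<le> t \<and> (\<forall>a\<in>N j. \<forall>b\<in>N j. a < b \<longrightarrow> a \<in> N b)"
    using part unfolding partial_partition_def by (elim conjE)
  then have N: "N j \<subseteq> {..<j}" "card (N j) \<le> t - 2" "\<forall>a\<in>N j. \<forall>b\<in>N j. a < b \<longrightarrow> a \<in> N b"
    if "j < n" for j using that by auto
  have fib: "\<forall>j<n. card {v \<in> pverts G - {}. f v = j} \<le> ?m"
    using part unfolding partial_partition_def by (elim conjE)
  have edges: "\<forall>u\<in>pverts G - {}. \<forall>v\<in>pverts G - {}. (u, v) \<in> parcs G \<longrightarrow>
      f u = f v \<or> f u \<in> N (f v) \<or> f v \<in> N (f u)"
    using part unfolding partial_partition_def by (elim conjE)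
  let ?H = "back_graph n N"
  have H: "pair_graph ?H" using N(1) by (rule pair_graph_back_graph)
  have "treewidth ?H \<le> int (t - 2)"
    by (rule treewidth_back_graph) (use N in auto)
  \<comment> \<open>The subtraction of naturals is exact because \<open>t \<ge> 2\<close>.\<close>
  then have "treewidth ?H \<le> int t - 2" using assms(1) by simp
  moreover have "isomorphic_to_subgraph G (?H \<boxtimes> complete_graph ?m)"
  proof (rule isomorphic_to_subgraph_strong_productI[OF assms(2) H])
    show "f v \<in> pverts ?H" if "v \<in> pverts G" for v using f that by (simp add: back_graph_def)
    show "card {v \<in> pverts G. f v = i} \<le> ?m" if "i \<in> pverts ?H" for i
      using fib that by (simp add: back_graph_def)
    show "f u = f v \<or> (f u, f v) \<in> parcs ?H" if "(u, v) \<in> parcs G" for u v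
      using edges f that pair_graphD(2)[OF assms(2)] by (fastforce simp: back_graph_def)
  qed
  ultimately show ?thesis using H by blast
qed

end
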